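(* Let $\Gamma$ be an $\widetilde A_2$ group with generating set $P$ and let $\Gamma_0$ be the abelian subgroup generated by three distinct mutually commuting elements $a,b,c\in P$ (so that $W^*(\Gamma_0)$ is a masa of $W^*(\Gamma)$). Then the Pukánszky invariant of the pair $(W^*(\Gamma_0),W^*(\Gamma))$ contains a type $I_\infty$ summand; that is, the type $I$ von Neumann algebra $\mathcal A'(1-p_1)$ has a nonzero direct summand of type $I_\infty$.
   Context: $\widetilde A_2$ groups: let $(P,L)$ be a finite projective plane of order $q\ge 2$ with point set $P$ and line set $L$. Let $\lambda:P\to L$ be a bijection. A triangle presentation compatible with $\lambda$ is a set $\mathcal T$ of triples $(x,y,z)$, $x,y,z\in P$, such that (i) given $x,y\in P$, $(x,y,z)\in\mathcal T$ for some $z\in P$ if and only if $y\in\lambda(x)$ ($y$ is incident with $\lambda(x)$); (ii) $(x,y,z)\in\mathcal T\Rightarrow (y,z,x)\in\mathcal T$; (iii) given $x,y\in P$, $(x,y,z)\in\mathcal T$ for at most one $z\in P$. The associated $\widetilde A_2$ group is $\Gamma=\langle a_x,\ x\in P \mid a_xa_ya_z=e \text{ for } (x,y,z)\in\mathcal T\rangle$. The point $x\in P$ is identified with the generator $a_x\in\Gamma$, so $P\subset\Gamma$. $W^*(\Gamma)$ is the group von Neumann algebra of $\Gamma$, generated by the left regular representation on $\ell^2(\Gamma)$; $W^*(\Gamma_0)$ is the subalgebra of elements supported in $\Gamma_0$. A masa is a maximal abelian von Neumann subalgebra. Pukánszky invariant: let $L_g\delta_h=\delta_{gh}$ and $R_g\delta_h=\delta_{hg}$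 be the left regular representation and right regular anti-representation on $\ell^2(\Gamma)$, and let $\mathcal A=(L_{\Gamma_0}\cup R_{\Gamma_0})''$, an abelian von Neumann subalgebra of $\mathcal B(\ell^2(\Gamma))$, with commutant $\mathcal A'$. Let $p_1$ be the orthogonal projection of $\ell^2(\Gamma)$ onto the closed subspace generated by $W^*(\Gamma_0)$, i.e. onto $\ell^2(\Gamma_0)$; $p_1$ lies in the centre of $\mathcal A'$. The Pukánszky invariant of $(W^*(\Gamma_0),W^*(\Gamma))$ is the type of the type $I$ von Neumann algebra $\mathcal A'(1-p_1)$. *)

theory Defs
  imports
    "HOL-Analysis.Infinite_Sum"
    "HOL-Library.Extended_Nat"
    "HOL-Algebra.Generated_Groups"
begin

section \<open>Groups given by generators and relators\<close>

text \<open>The letter \<open>(x, True)\<close> stands for the generator \<open>x\<close> and \<open>(x, False)\<close> for its formal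
  inverse.\<close>

definition words :: "'x set \<Rightarrow> ('x \<times> bool) list set" where
  "words S = lists (S \<times> UNIV)"

inductive_set word_rel ::
    "'x set \<Rightarrow> ('x \<times> bool) list set \<Rightarrow> (('x \<times> bool) list \<times> ('x \<times> bool) list) set"
  for S :: "'x set" and R :: "('x \<times> bool) list set" where
  refl: "w \<in> words S \<Longrightarrow> (w, w) \<in> word_rel S R"
| sym: "(u, v) \<in> word_rel S R \<Longrightarrow> (v, u) \<in> word_rel S R"
| trans: "(u, v) \<in> word_rel S R \<Longrightarrow> (v, w) \<in> word_rel S R \<Longrightarrow> (u, w) \<in> word_rel S R"
| cancel: "u \<in> words S \<Longrightarrow> v \<in> words S \<Longrightarrow> x \<in> S \<Longrightarrow>
    (u @ [(x, s), (x, \<not> s)] @ v, u @ v) \<in> word_rel S R"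
| relator: "u \<in> words S \<Longrightarrow> v \<in> words S \<Longrightarrow> r \<in> R \<Longrightarrow> r \<in> words S \<Longrightarrow>
    (u @ r @ v, u @ v) \<in> word_rel S R"

definition presented_group ::
    "'x set \<Rightarrow> ('x \<times> bool) list set \<Rightarrow> ('x \<times> bool) list set monoid" where
  "presented_group S R =
    \<lparr> carrier = words S // word_rel S R,
      mult = (\<lambda>A B. \<Union>u\<in>A. \<Union>v\<in>B. word_rel S R `` {u @ v}),
      one = word_rel S R `` {[]} \<rparr>"

definition generator ::
    "'x set \<Rightarrow> ('x \<times> bool) list set \<Rightarrow> 'x \<Rightarrow> ('x \<times> bool) list set" where
  "generator S R x = word_rel S R `` {[(x, True)]}"

lemma words_append [simp]: "u @ v \<in> words S \<longleftrightarrow> u \<in> words S \<and> v \<in> words S"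
  by (auto simp: words_def)

lemma words_Nil [simp]: "[] \<in> words S"
  by (simp add: words_def)

lemma words_Cons [simp]: "l # v \<in> words S \<longleftrightarrow> fst l \<in> S \<and> v \<in> words S"
  by (cases l) (auto simp: words_def)

lemma word_rel_words: "(u, v) \<in> word_rel S R \<Longrightarrow> u \<in> words S \<and> v \<in> words S"
  by (induction rule: word_rel.induct) auto

lemma equiv_word_rel: "equiv (words S) (word_rel S R)"
proof (rule equivI)
  show "word_rel S R \<subseteq> words S \<times> words S"
    using word_rel_words by fastforce
  show "refl_on (words S) (word_rel S R)"
    by (simp add: refl_on_def word_rel.refl)
  show "sym (word_rel S R)"
    by (rule symI) (rule word_rel.sym)
  show "trans (word_rel S R)"
    by (rule transI) (rule word_rel.trans)
qed

lemma word_rel_context: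
  "(u, v) \<in> word_rel S R \<Longrightarrow> p \<in> words S \<Longrightarrow> s \<in> words S \<Longrightarrow>
    (p @ u @ s, p @ v @ s) \<in> word_rel S R"
proof (induction rule: word_rel.induct)
  case (refl w)
  then show ?case by (intro word_rel.refl) auto
next
  case (sym u v)
  show ?case by (rule word_rel.sym) (rule sym.IH[OF sym.prems])
next
  case (trans u v w)
  show ?case
    by (rule word_rel.trans) (rule trans.IH(1)[OF trans.prems], rule trans.IH(2)[OF trans.prems])
next
  case (cancel u v x t)
  then show ?case
    using word_rel.cancel[of "p @ u" S "v @ s" x t R] by simp
next
  case (relator u v r)
  then show ?case
    using word_rel.relator[of "p @ u" S "v @ s" r R] by simp
qed

lemma word_rel_append:
  assumes "(u, u') \<in> word_rel S R" "(v, v') \<in> word_rel S R"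
  shows "(u @ v, u' @ v') \<in> word_rel S R"
proof -
  have "u' \<in> words S" "v \<in> words S"
    using assms word_rel_words by blast+
  then have "(u @ v, u' @ v) \<in> word_rel S R" "(u' @ v, u' @ v') \<in> word_rel S R"
    using word_rel_context[OF assms(1), of "[]" v] word_rel_context[OF assms(2), of u' "[]"]
    by auto
  then show ?thesis by (rule word_rel.trans)
qed

lemma mult_presented_group_class:
  assumes "u \<in> words S" "v \<in> words S"
  shows "(word_rel S R `` {u}) \<otimes>\<^bsub>presented_group S R\<^esub> (word_rel S R `` {v})
    = word_rel S R `` {u @ v}"
proof -
  have *: "word_rel S R `` {u' @ v'} = word_rel S R `` {u @ v}"
    if "(u, u') \<in> word_rel S R" "(v, v') \<in> word_rel S R" for u' v'
    using equiv_class_eq[OF equiv_word_rel word_rel_append[OF that]] by simp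
  have "(u, u) \<in> word_rel S R" "(v, v) \<in> word_rel S R"
    using assms by (auto intro: word_rel.refl)
  then have "(\<Union>u'\<in>word_rel S R `` {u}. \<Union>v'\<in>word_rel S R `` {v}. word_rel S R `` {u' @ v'})
      = word_rel S R `` {u @ v}"
    using * by blast
  then show ?thesis
    by (simp add: presented_group_def)
qed

lemma word_rel_inverse:
  assumes "w \<in> words S"
  shows "(rev (map (\<lambda>(x, s). (x, \<not> s)) w) @ w, []) \<in> word_rel S R"
  using assms
proof (induction w)
  case Nil
  then show ?case by (auto intro: word_rel.refl)
next
  case (Cons l w)
  obtain x s where l: "l = (x, s)" by (cases l)
  let ?i = "rev (map (\<lambda>(x, s). (x, \<not> s)) w)"
  have i: "?i \<in> words S"
    using Cons.prems by (fastforce simp: words_def)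
  then have "(?i @ [(x, \<not> s), (x, \<not> \<not> s)] @ w, ?i @ w) \<in> word_rel S R"
    by (rule word_rel.cancel) (use Cons.prems l in auto)
  then have "(?i @ [(x, \<not> s), (x, s)] @ w, ?i @ w) \<in> word_rel S R"
    by simp
  moreover have "(?i @ w, []) \<in> word_rel S R"
    using Cons by auto
  ultimately have "(?i @ [(x, \<not> s), (x, s)] @ w, []) \<in> word_rel S R"
    by (rule word_rel.trans)
  then show ?case
    using l by simp
qed

lemma group_presented_group: "group (presented_group S R)"
proof (rule groupI)
  let ?G = "presented_group S R"
  have carr: "carrier ?G = words S // word_rel S R"
    and one: "\<one>\<^bsub>?G\<^esub> = word_rel S R `` {[]}"
    by (auto simp: presented_group_def)
  fix A B C assume "A \<in> carrier ?G" "B \<in> carrier ?G"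
  then obtain u v where
    A: "u \<in> words S" "A = word_rel S R `` {u}" and B: "v \<in> words S" "B = word_rel S R `` {v}"
    unfolding carr by (auto elim!: quotientE)
  show "A \<otimes>\<^bsub>?G\<^esub> B \<in> carrier ?G"
    using A B by (auto simp: mult_presented_group_class carr intro!: quotientI)
  show "\<one>\<^bsub>?G\<^esub> \<otimes>\<^bsub>?G\<^esub> A = A"
    using A by (simp add: one mult_presented_group_class)
  {
    assume "C \<in> carrier ?G"
    then obtain w where C: "w \<in> words S" "C = word_rel S R `` {w}"
      unfolding carr by (auto elim!: quotientE)
    show "A \<otimes>\<^bsub>?G\<^esub> B \<otimes>\<^bsub>?G\<^esub> C = A \<otimes>\<^bsub>?G\<^esub> (B \<otimes>\<^bsub>?G\<^esub> C)"
      using A B C by (simp add: mult_presented_group_class)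
  }
  let ?i = "rev (map (\<lambda>(x, s). (x, \<not> s)) u)"
  have i: "?i \<in> words S"
    using A(1) by (fastforce simp: words_def)
  have "(word_rel S R `` {?i}) \<otimes>\<^bsub>?G\<^esub> A = \<one>\<^bsub>?G\<^esub>"
    using A i equiv_class_eq[OF equiv_word_rel word_rel_inverse[OF A(1)]]
    by (simp add: one mult_presented_group_class)
  then show "\<exists>y\<in>carrier ?G. y \<otimes>\<^bsub>?G\<^esub> A = \<one>\<^bsub>?G\<^esub>"
    using i carr by (auto intro!: quotientI)
next
  show "\<one>\<^bsub>presented_group S R\<^esub> \<in> carrier (presented_group S R)"
    by (auto simp: presented_group_def intro!: quotientI)
qed


section \<open>Triangle presentations and their groups\<close>

locale finite_projective_plane =
  fixes P :: "'p set" and L :: "'l set" and I :: "'p \<Rightarrow> 'l \<Rightarrow> bool" and q :: nat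
  assumes finite_points: "finite P" and finite_lines: "finite L"
    and unique_line: "\<And>x y. x \<in> P \<Longrightarrow> y \<in> P \<Longrightarrow> x \<noteq> y \<Longrightarrow> \<exists>!l. l \<in> L \<and> I x l \<and> I y l"
    and unique_point: "\<And>l m. l \<in> L \<Longrightarrow> m \<in> L \<Longrightarrow> l \<noteq> m \<Longrightarrow> \<exists>!x. x \<in> P \<and> I x l \<and> I x m"
    and quadrangle: "\<exists>Q\<subseteq>P. card Q = 4 \<and> (\<forall>l\<in>L. card {x \<in> Q. I x l} \<le> 2)"
    and order: "\<And>l. l \<in> L \<Longrightarrow> card {x \<in> P. I x l} = q + 1"

locale triangle_presentation = finite_projective_plane P L I q
  for P :: "'p set" and L :: "'l set" and I :: "'p \<Rightarrow> 'l \<Rightarrow> bool" and q :: nat +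
  fixes lam :: "'p \<Rightarrow> 'l" and T :: "('p \<times> 'p \<times> 'p) set"
  assumes bij_lam: "bij_betw lam P L"
    and triples: "T \<subseteq> P \<times> P \<times> P"
    and extends_iff: "\<And>x y. x \<in> P \<Longrightarrow> y \<in> P \<Longrightarrow> (\<exists>z\<in>P. (x, y, z) \<in> T) \<longleftrightarrow> I y (lam x)"
    and cyclic: "\<And>x y z. (x, y, z) \<in> T \<Longrightarrow> (y, z, x) \<in> T"
    and unique_third: "\<And>x y z z'. (x, y, z) \<in> T \<Longrightarrow> (x, y, z') \<in> T \<Longrightarrow> z = z'"

definition triangle_relators :: "('p \<times> 'p \<times> 'p) set \<Rightarrow> ('p \<times> bool) list set" where
  "triangle_relators T = {[(x, True), (y, True), (z, True)] | x y z. (x, y, z) \<in> T}"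

definition A2_group ::
    "'p set \<Rightarrow> ('p \<times> 'p \<times> 'p) set \<Rightarrow> ('p \<times> bool) list set monoid" where
  "A2_group P T = presented_group P (triangle_relators T)"

definition A2_generator ::
    "'p set \<Rightarrow> ('p \<times> 'p \<times> 'p) set \<Rightarrow> 'p \<Rightarrow> ('p \<times> bool) list set" where
  "A2_generator P T x = generator P (triangle_relators T) x"


section \<open>Operators on the Hilbert space of square-summable functions\<close>

text \<open>Since the index set is a carrier set rather than a type, vectors are functions vanishing off
  \<open>X\<close>. Operators are defined to be \<open>0\<close> on functions outside \<open>ell2 X\<close>, so that equality of
  operators is equality of functions.\<close>

definition ell2 :: "'a set \<Rightarrow> ('a \<Rightarrow> complex) set" where
  "ell2 X = {f. (\<forall>x. x \<notin> X \<longrightarrow> f x = 0) \<and> (\<lambda>x. (cmod (f x))\<^sup>2) summable_on X}"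

definition ell2_inner :: "'a set \<Rightarrow> ('a \<Rightarrow> complex) \<Rightarrow> ('a \<Rightarrow> complex) \<Rightarrow> complex" where
  "ell2_inner X f g = (\<Sum>\<^sub>\<infinity>x\<in>X. f x * cnj (g x))"

definition ell2_norm :: "'a set \<Rightarrow> ('a \<Rightarrow> complex) \<Rightarrow> real" where
  "ell2_norm X f = sqrt (\<Sum>\<^sub>\<infinity>x\<in>X. (cmod (f x))\<^sup>2)"

type_synonym 'a operator = "('a \<Rightarrow> complex) \<Rightarrow> ('a \<Rightarrow> complex)"

definition operator_on :: "'a set \<Rightarrow> 'a operator \<Rightarrow> 'a operator" where
  "operator_on X F = (\<lambda>f. if f \<in> ell2 X then F f else (\<lambda>_. 0))"

definition bounded_operators :: "'a set \<Rightarrow> 'a operator set" where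
  "bounded_operators X = {A.
     (\<forall>f. f \<notin> ell2 X \<longrightarrow> A f = (\<lambda>_. 0)) \<and>
     (\<forall>f\<in>ell2 X. A f \<in> ell2 X) \<and>
     (\<forall>f\<in>ell2 X. \<forall>g\<in>ell2 X. A (\<lambda>x. f x + g x) = (\<lambda>x. A f x + A g x)) \<and>
     (\<forall>c. \<forall>f\<in>ell2 X. A (\<lambda>x. c * f x) = (\<lambda>x. c * A f x)) \<and>
     (\<exists>C. \<forall>f\<in>ell2 X. ell2_norm X (A f) \<le> C * ell2_norm X f)}"

definition is_adjoint :: "'a set \<Rightarrow> 'a operator \<Rightarrow> 'a operator \<Rightarrow> bool" where
  "is_adjoint X A B \<longleftrightarrow>
    (\<forall>f\<in>ell2 X. \<forall>g\<in>ell2 X. ell2_inner X (A f) g = ell2_inner X f (B g))"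

definition is_projection :: "'a set \<Rightarrow> 'a operator \<Rightarrow> bool" where
  "is_projection X p \<longleftrightarrow> p \<in> bounded_operators X \<and> p \<circ> p = p \<and> is_adjoint X p p"

definition commutant :: "'a set \<Rightarrow> 'a operator set \<Rightarrow> 'a operator set" where
  "commutant X S = {A \<in> bounded_operators X. \<forall>B\<in>S. A \<circ> B = B \<circ> A}"


section \<open>Homogeneous type I von Neumann algebras\<close>

text \<open>In this section \<open>M\<close> is a von Neumann algebra acting on the range of a projection of
  \<open>ell2 X\<close>, and regarded as a set of operators on all of \<open>ell2 X\<close>. Its unit is therefore that
  projection and not necessarily the identity of \<open>ell2 X\<close>.\<close>

definition reduced_algebra :: "'a operator set \<Rightarrow> 'a operator \<Rightarrow> 'a operator set" where
  "reduced_algebra M p = {A \<circ> p | A. A \<in> M}"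

definition central_projection :: "'a set \<Rightarrow> 'a operator set \<Rightarrow> 'a operator \<Rightarrow> bool" where
  "central_projection X M z \<longleftrightarrow> is_projection X z \<and> z \<in> M \<and> (\<forall>A\<in>M. z \<circ> A = A \<circ> z)"

definition abelian_projection :: "'a set \<Rightarrow> 'a operator set \<Rightarrow> 'a operator \<Rightarrow> bool" where
  "abelian_projection X M e \<longleftrightarrow> is_projection X e \<and> e \<in> M \<and>
    (\<forall>A\<in>M. \<forall>B\<in>M. (e \<circ> A \<circ> e) \<circ> (e \<circ> B \<circ> e) = (e \<circ> B \<circ> e) \<circ> (e \<circ> A \<circ> e))"

definition equivalent_projections ::
    "'a set \<Rightarrow> 'a operator set \<Rightarrow> 'a operator \<Rightarrow> 'a operator \<Rightarrow> bool" where
  "equivalent_projections X M e f \<longleftrightarrow>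
    (\<exists>v\<in>M. \<exists>w\<in>M. is_adjoint X v w \<and> w \<circ> v = e \<and> v \<circ> w = f)"

text \<open>\<open>M\<close>, with unit \<open>u\<close>, is of type \<open>I\<^sub>n\<close> if \<open>u\<close> is the strongly convergent sum of \<open>n\<close> mutually
  orthogonal equivalent abelian projections. For \<open>n = \<infinity>\<close> the family is countably infinite, which is
  the only infinite cardinality possible when \<open>X\<close> is countable.\<close>

definition homogeneous_type_I ::
    "'a set \<Rightarrow> 'a operator set \<Rightarrow> 'a operator \<Rightarrow> enat \<Rightarrow> bool" where
  "homogeneous_type_I X M u n \<longleftrightarrow>
    (let J = {i. enat i < n} in
     \<exists>e. (\<forall>i\<in>J. abelian_projection X M (e i)) \<and>
         (\<forall>i\<in>J. \<forall>j\<in>J. equivalent_projections X M (e i) (e j)) \<and>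
         (\<forall>i\<in>J. \<forall>j\<in>J. i \<noteq> j \<longrightarrow> e i \<circ> e j = (\<lambda>_ _. 0)) \<and>
         (\<forall>f\<in>ell2 X.
           ((\<lambda>F. ell2_norm X (\<lambda>x. (\<Sum>i\<in>F. e i f x) - u f x)) \<longlongrightarrow> 0) (finite_subsets_at_top J)))"

definition has_type_I_summand :: "'a set \<Rightarrow> 'a operator set \<Rightarrow> enat \<Rightarrow> bool" where
  "has_type_I_summand X M n \<longleftrightarrow>
    (\<exists>z. central_projection X M z \<and> z \<noteq> (\<lambda>_ _. 0) \<and>
         homogeneous_type_I X (reduced_algebra M z) z n)"


section \<open>The Pukanszky invariant\<close>

definition left_regular :: "('a, 'm) monoid_scheme \<Rightarrow> 'a \<Rightarrow> 'a operator" where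
  "left_regular G g = operator_on (carrier G)
    (\<lambda>f h. if h \<in> carrier G then f (inv\<^bsub>G\<^esub> g \<otimes>\<^bsub>G\<^esub> h) else 0)"

definition right_regular :: "('a, 'm) monoid_scheme \<Rightarrow> 'a \<Rightarrow> 'a operator" where
  "right_regular G g = operator_on (carrier G)
    (\<lambda>f h. if h \<in> carrier G then f (h \<otimes>\<^bsub>G\<^esub> inv\<^bsub>G\<^esub> g) else 0)"

definition left_right_algebra :: "('a, 'm) monoid_scheme \<Rightarrow> 'a set \<Rightarrow> 'a operator set" where
  "left_right_algebra G H = commutant (carrier G) (commutant (carrier G)
    (left_regular G ` H \<union> right_regular G ` H))"

text \<open>The orthogonal projection of \<open>ell2 X\<close> onto \<open>ell2 H\<close>, for \<open>H \<subseteq> X\<close>, and its complement.\<close>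

definition ell2_projection :: "'a set \<Rightarrow> 'a set \<Rightarrow> 'a operator" where
  "ell2_projection X H = operator_on X (\<lambda>f x. if x \<in> H then f x else 0)"

definition complement_projection :: "'a set \<Rightarrow> 'a operator \<Rightarrow> 'a operator" where
  "complement_projection X p = operator_on X (\<lambda>f x. f x - p f x)"

definition pukanszky_invariant :: "('a, 'm) monoid_scheme \<Rightarrow> 'a set \<Rightarrow> enat set" where
  "pukanszky_invariant G H =
    {n. has_type_I_summand (carrier G)
      (reduced_algebra (commutant (carrier G) (left_right_algebra G H))
        (complement_projection (carrier G) (ell2_projection (carrier G) H))) n}"

abbreviation point_mass :: "'a \<Rightarrow> 'a \<Rightarrow> complex" where
  "point_mass h \<equiv> (\<lambda>x. if x = h then 1 else 0)"

lemma point_mass_ell2: "h \<in> X \<Longrightarrow> point_mass h \<in> ell2 X"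
proof -
  assume "h \<in> X"
  have "(\<lambda>x. (cmod (point_mass h x))\<^sup>2) summable_on X \<longleftrightarrow>
      (\<lambda>x. (cmod (point_mass h x))\<^sup>2) summable_on {h}"
    using \<open>h \<in> X\<close> by (intro summable_on_cong_neutral) auto
  then show ?thesis
    using \<open>h \<in> X\<close> by (auto simp: ell2_def)
qed

lemma left_regular_point_mass:
  assumes "group G" "g \<in> carrier G" "h \<in> carrier G"
  shows "left_regular G g (point_mass h) = point_mass (g \<otimes>\<^bsub>G\<^esub> h)"
proof -
  interpret group G by fact
  have "inv\<^bsub>G\<^esub> g \<otimes>\<^bsub>G\<^esub> x = h \<longleftrightarrow> x = g \<otimes>\<^bsub>G\<^esub> h" if "x \<in> carrier G" for x
    using assms that by (metis inv_solve_left)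
  then show ?thesis
    using assms by (auto simp: left_regular_def operator_on_def point_mass_ell2 fun_eq_iff)
qed

lemma right_regular_point_mass:
  assumes "group G" "g \<in> carrier G" "h \<in> carrier G"
  shows "right_regular G g (point_mass h) = point_mass (h \<otimes>\<^bsub>G\<^esub> g)"
proof -
  interpret group G by fact
  have "x \<otimes>\<^bsub>G\<^esub> inv\<^bsub>G\<^esub> g = h \<longleftrightarrow> x = h \<otimes>\<^bsub>G\<^esub> g" if "x \<in> carrier G" for x
    using assms that by (metis inv_solve_right)
  then show ?thesis
    using assms by (auto simp: right_regular_def operator_on_def point_mass_ell2 fun_eq_iff)
qed

end

theory Submission
  imports Defs
begin

text \<open>
  Write \<open>H = \<Gamma>\<^sub>0\<close>. The abelian group \<open>H \<times> H\<close> acts on \<open>\<Gamma>\<close> by \<open>x \<mapsto> h x k\<close>, the orbits are the double cosets,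
  and the algebra in question is the commutant of the resulting unitary representation on \<open>\<ell>\<^sup>2(\<Gamma>)\<close>.
  A double coset on which the action is free carries the regular representation of \<open>H \<times> H\<close>. If there
  are infinitely many of them, they carry a summand of infinite multiplicity, which is the claim,
  once it is known that this summand is cut out by a central projection.

  Let \<open>z\<close> be the projection onto the functions supported in the free double cosets. It is central
  because \<open>H\<close> has no torsion: a point that is not free has an infinite stabiliser, and an operator that
  commutes with the action cannot connect it to a free point without repeating one coefficient
  infinitely often (\<open>K_coefficient_free_nonfree\<close>). The projections onto the individual free double
  cosets are abelian, since the operators in their corners are convolutions over an abelian
  group (\<open>corner_commute\<close>). They are equivalent, since any two free orbits are isomorphic
  (\<open>orbits_equivalent\<close>), and they add up to \<open>z\<close> (\<open>orbit_exhaustion\<close>).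

  It remains to find infinitely many free double cosets, and this takes place in the flat of \<open>\<Gamma>\<^sub>0\<close> in the
  building of \<open>\<Gamma>\<close>. The relations of \<open>\<Gamma>\<close> are turned into a terminating and confluent rewriting
  system (\<open>overlaps_joinable\<close>, \<open>step_locally_confluent\<close>) whose normal forms are unique and shortest.
  Three commuting generators satisfy \<open>a b c = b a c = 1\<close>, so that \<open>a\<close>, \<open>b\<close>, \<open>c\<close> are the vertices of a triangle
  with sides \<open>\<lambda>(a)\<close>, \<open>\<lambda>(b)\<close>, \<open>\<lambda>(c)\<close>, and every element of \<open>\<Gamma>\<^sub>0\<close> is a normal form \<open>u\<^sup>m v\<^sup>-\<^sup>n\<close>
  with \<open>u \<noteq> v\<close> in \<open>{a, b, c}\<close>. Now let \<open>g\<close> be a positive normal form whose first letter lies on no side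
  of the triangle and whose last letter \<open>x\<close> is such that the line \<open>\<lambda>(x)\<close> contains no vertex.
  Geometrically, \<open>g\<close> is a path from the flat to its translate that makes an angle of at least \<open>2\<pi>/3\<close>
  with every edge of either flat at its end points; a nontrivial relation \<open>h g k = g\<close> would produce a quadrilateral
  with too large an angle sum. In terms of words, \<open>h g k\<close> exceeds \<open>g\<close> in length by an amount that
  is bounded below in terms of \<open>h\<close> and \<open>k\<close> (\<open>transverse_length_increase\<close>). Applied to \<open>h g k = g'\<close> and to
  \<open>g = h\<^sup>-\<^sup>1 g' k\<^sup>-\<^sup>1\<close>, this forces \<open>h = k = 1\<close>. A count of points shows that such \<open>g\<close> exist in
  every sufficiently large odd length.
\<close>

section \<open>Square-summable functions and matrix coefficients\<close>

lemma ell2_zero [simp]: "(\<lambda>_. 0) \<in> ell2 X"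
  by (simp add: ell2_def)

lemma ell2_summable_on:
  assumes "f \<in> ell2 X" "Y \<subseteq> X"
  shows "(\<lambda>x. (cmod (f x))\<^sup>2) summable_on Y"
  using assms summable_on_subset_banach by (auto simp: ell2_def)

lemma ell2_outside: "f \<in> ell2 X \<Longrightarrow> x \<notin> X \<Longrightarrow> f x = 0"
  by (simp add: ell2_def)

lemma ell2_add:
  assumes "f \<in> ell2 X" "g \<in> ell2 X"
  shows "(\<lambda>x. f x + g x) \<in> ell2 X"
proof -
  have "(cmod (f x + g x))\<^sup>2 \<le> 2 * (cmod (f x))\<^sup>2 + 2 * (cmod (g x))\<^sup>2" for x
  proof -
    have "(cmod (f x + g x))\<^sup>2 \<le> (cmod (f x) + cmod (g x))\<^sup>2"
      by (intro power_mono norm_triangle_ineq) auto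
    also have "\<dots> \<le> 2 * (cmod (f x))\<^sup>2 + 2 * (cmod (g x))\<^sup>2"
      using sum_squares_bound[of "cmod (f x)" "cmod (g x)"] by (simp add: power2_sum)
    finally show ?thesis .
  qed
  moreover have "(\<lambda>x. 2 * (cmod (f x))\<^sup>2 + 2 * (cmod (g x))\<^sup>2) summable_on X"
    using assms by (intro summable_on_add summable_on_cmult_right) (auto simp: ell2_def)
  ultimately have "(\<lambda>x. norm ((cmod (f x + g x))\<^sup>2)) summable_on X"
    by - (erule summable_on_comparison_test, simp_all)
  then show ?thesis
    using assms by (auto simp: ell2_def)
qed

lemma ell2_scale: "f \<in> ell2 X \<Longrightarrow> (\<lambda>x. c * f x) \<in> ell2 X"
  by (auto simp: ell2_def norm_mult power_mult_distrib intro: summable_on_cmult_right)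

lemma ell2_restrict:
  assumes "f \<in> ell2 X" shows "(\<lambda>x. if x \<in> Y then f x else 0) \<in> ell2 X"
proof -
  have "(\<lambda>x. norm ((cmod (if x \<in> Y then f x else 0))\<^sup>2)) summable_on X"
    by (rule summable_on_comparison_test[OF ell2_summable_on[OF assms subset_refl]]) auto
  then show ?thesis
    using assms by (auto simp: ell2_def)
qed

lemma ell2_norm_square: "(ell2_norm X f)\<^sup>2 = (\<Sum>\<^sub>\<infinity>x\<in>X. (cmod (f x))\<^sup>2)"
  by (simp add: ell2_norm_def infsum_nonneg)

lemma ell2_norm_nonneg [simp]: "ell2_norm X f \<ge> 0"
  by (simp add: ell2_norm_def infsum_nonneg)

lemma ell2_norm_restrict:
  assumes "Y \<subseteq> X"
  shows "(ell2_norm X (\<lambda>x. if x \<in> Y then f x else 0))\<^sup>2 = (\<Sum>\<^sub>\<infinity>x\<in>Y. (cmod (f x))\<^sup>2)"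
  unfolding ell2_norm_square using assms by (intro infsum_cong_neutral) auto

lemma sum_squares_le_ell2_norm:
  assumes "f \<in> ell2 X" "finite E" "E \<subseteq> X"
  shows "(\<Sum>x\<in>E. (cmod (f x))\<^sup>2) \<le> (ell2_norm X f)\<^sup>2"
  unfolding ell2_norm_square
  by (rule finite_sum_le_infsum) (use assms in \<open>auto simp: ell2_def\<close>)

lemma cmod_le_ell2_norm:
  assumes "f \<in> ell2 X" shows "cmod (f x) \<le> ell2_norm X f"
proof (cases "x \<in> X")
  case True
  then have "(cmod (f x))\<^sup>2 \<le> (ell2_norm X f)\<^sup>2"
    using sum_squares_le_ell2_norm[of f X "{x}"] assms by simp
  then show ?thesis
    using ell2_norm_nonneg power2_le_imp_le by blast
qed (use assms in \<open>simp add: ell2_outside\<close>)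

text \<open>A nonzero constant is not square-summable over an infinite set. This is applied to the
  columns of a matrix; the corresponding fact for rows is \<open>bounded_operator_constant_row_imp_zero\<close>.\<close>

lemma ell2_constant_on_infinite_imp_zero:
  assumes f: "f \<in> ell2 X" and "infinite Z" "Z \<subseteq> X" and c: "\<And>x. x \<in> Z \<Longrightarrow> f x = c"
  shows "c = 0"
proof (rule ccontr)
  assume "c \<noteq> 0"
  obtain n :: nat where n: "(ell2_norm X f)\<^sup>2 < of_nat n * (cmod c)\<^sup>2"
    using \<open>c \<noteq> 0\<close> by (metis ex_less_of_nat_mult zero_less_norm_iff zero_less_power)
  obtain E where E: "E \<subseteq> Z" "finite E" "card E = n"
    using \<open>infinite Z\<close> by (meson infinite_arbitrarily_large)
  then have "(\<Sum>x\<in>E. (cmod (f x))\<^sup>2) = of_nat n * (cmod c)\<^sup>2"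
    using c by (simp add: subset_iff)
  then show False
    using sum_squares_le_ell2_norm[OF f E(2)] E assms(3) n by auto
qed

lemma ell2_small_tail:
  assumes f: "f \<in> ell2 X" and "\<epsilon> > 0"
  obtains E where "finite E" "E \<subseteq> X"
    "\<And>Y. Y \<subseteq> X \<Longrightarrow> Y \<inter> E = {} \<Longrightarrow> ell2_norm X (\<lambda>x. if x \<in> Y then f x else 0) < \<epsilon>"
proof -
  let ?g = "\<lambda>x. (cmod (f x))\<^sup>2"
  have s: "?g summable_on Y" if "Y \<subseteq> X" for Y
    using ell2_summable_on[OF f that] .
  obtain E where E: "finite E" "E \<subseteq> X" "dist (sum ?g E) (infsum ?g X) \<le> \<epsilon>\<^sup>2 / 2"
    using infsum_finite_approximation[OF s[OF subset_refl], of "\<epsilon>\<^sup>2 / 2"] \<open>\<epsilon> > 0\<close> by auto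
  show ?thesis
  proof (rule that[OF E(1,2)])
    fix Y assume Y: "Y \<subseteq> X" "Y \<inter> E = {}"
    have "infsum ?g Y \<le> infsum ?g (X - E)"
      by (rule infsum_mono2) (use Y s in auto)
    also have "\<dots> = infsum ?g X - sum ?g E"
      using infsum_Diff[of ?g X E] s E by (simp add: summable_on_finite)
    also have "\<dots> < \<epsilon>\<^sup>2"
    proof -
      have "\<epsilon>\<^sup>2 > 0" using \<open>\<epsilon> > 0\<close> by simp
      then show ?thesis using E(3) unfolding dist_real_def by linarith
    qed
    finally show "ell2_norm X (\<lambda>x. if x \<in> Y then f x else 0) < \<epsilon>"
      unfolding ell2_norm_restrict[OF Y(1), of f, symmetric]
      by (rule power2_less_imp_less) (use \<open>\<epsilon> > 0\<close> in simp)
  qed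
qed

lemma bounded_operatorsD:
  assumes "A \<in> bounded_operators X"
  shows "f \<notin> ell2 X \<Longrightarrow> A f = (\<lambda>_. 0)" "f \<in> ell2 X \<Longrightarrow> A f \<in> ell2 X"
    "f \<in> ell2 X \<Longrightarrow> g \<in> ell2 X \<Longrightarrow> A (\<lambda>x. f x + g x) = (\<lambda>x. A f x + A g x)"
    "f \<in> ell2 X \<Longrightarrow> A (\<lambda>x. k * f x) = (\<lambda>x. k * A f x)"
    "A (\<lambda>_. 0) = (\<lambda>_. 0)"
proof -
  have *: "\<forall>c. \<forall>f\<in>ell2 X. A (\<lambda>x. c * f x) = (\<lambda>x. c * A f x)"
    using assms by (auto simp: bounded_operators_def)
  from *[rule_format, of "\<lambda>_. 0" 0] show "A (\<lambda>_. 0) = (\<lambda>_. 0)" by simp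
qed (use assms in \<open>auto simp: bounded_operators_def\<close>)

lemma bounded_operators_bound:
  assumes "A \<in> bounded_operators X"
  obtains C where "C > 0" "\<And>f. f \<in> ell2 X \<Longrightarrow> ell2_norm X (A f) \<le> C * ell2_norm X f"
proof -
  obtain C where C: "\<And>f. f \<in> ell2 X \<Longrightarrow> ell2_norm X (A f) \<le> C * ell2_norm X f"
    using assms unfolding bounded_operators_def by blast
  show ?thesis
  proof (rule that[of "\<bar>C\<bar> + 1"])
    fix f assume "f \<in> ell2 X"
    then have "ell2_norm X (A f) \<le> C * ell2_norm X f" by (rule C)
    also have "\<dots> \<le> (\<bar>C\<bar> + 1) * ell2_norm X f" by (intro mult_right_mono) auto
    finally show "ell2_norm X (A f) \<le> (\<bar>C\<bar> + 1) * ell2_norm X f" .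
  qed auto
qed

lemma bounded_operators_comp:
  assumes A: "A \<in> bounded_operators X" and B: "B \<in> bounded_operators X"
  shows "A \<circ> B \<in> bounded_operators X"
proof -
  obtain C where C: "C > 0" "\<And>f. f \<in> ell2 X \<Longrightarrow> ell2_norm X (A f) \<le> C * ell2_norm X f"
    using bounded_operators_bound[OF A] by blast
  obtain D where D: "D > 0" "\<And>f. f \<in> ell2 X \<Longrightarrow> ell2_norm X (B f) \<le> D * ell2_norm X f"
    using bounded_operators_bound[OF B] by blast
  have "ell2_norm X (A (B f)) \<le> (C * D) * ell2_norm X f" if "f \<in> ell2 X" for f
  proof -
    have "ell2_norm X (A (B f)) \<le> C * ell2_norm X (B f)"
      by (rule C(2)) (rule bounded_operatorsD(2)[OF B that])
    also have "\<dots> \<le> C * (D * ell2_norm X f)"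
      using C(1) D(2)[OF that] by (intro mult_left_mono) auto
    finally show ?thesis by (simp add: mult.assoc)
  qed
  then have "\<exists>C. \<forall>f\<in>ell2 X. ell2_norm X (A (B f)) \<le> C * ell2_norm X f" by blast
  then show ?thesis
    unfolding bounded_operators_def
    using bounded_operatorsD[OF A] bounded_operatorsD[OF B] by simp
qed

lemma bounded_operator_finite_support:
  assumes A: "A \<in> bounded_operators X" and "finite E" "E \<subseteq> X"
  shows "(\<lambda>x. if x \<in> E then f x else 0) \<in> ell2 X \<and>
    A (\<lambda>x. if x \<in> E then f x else 0) = (\<lambda>y. \<Sum>x\<in>E. f x * A (point_mass x) y)"
  using assms(2,3)
proof (induction E rule: finite_induct)
  case empty
  then show ?case using bounded_operatorsD(5)[OF A] by simp
next
  case (insert a E)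
  let ?r = "\<lambda>x. if x \<in> E then f x else 0"
  have eq: "(\<lambda>x. if x \<in> insert a E then f x else 0) = (\<lambda>x. f a * point_mass a x + ?r x)"
    using insert.hyps by (auto simp: fun_eq_iff)
  have a: "point_mass a \<in> ell2 X"
    using insert.prems by (simp add: point_mass_ell2)
  note IH = insert.IH[OF subset_trans[OF subset_insertI insert.prems]]
  have "A (\<lambda>x. f a * point_mass a x + ?r x) = (\<lambda>y. f a * A (point_mass a) y + A ?r y)"
    using IH ell2_scale[OF a, of "f a"] bounded_operatorsD(4)[OF A a, of "f a"]
    by (subst bounded_operatorsD(3)[OF A]) auto
  then show ?case
    unfolding eq using IH insert.hyps ell2_add[OF ell2_scale[OF a, of "f a"]] by simp
qed

text \<open>Continuity turns the finite expansion of the previous lemma into a convergent one, so that a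
  bounded operator is its matrix.\<close>

lemma bounded_operator_matrix:
  assumes A: "A \<in> bounded_operators X" and f: "f \<in> ell2 X"
  shows "((\<lambda>x. f x * A (point_mass x) y) has_sum A f y) X"
  unfolding has_sum_def tendsto_iff
proof (intro allI impI)
  fix \<epsilon> :: real assume "\<epsilon> > 0"
  obtain C where C: "C > 0" "\<And>f. f \<in> ell2 X \<Longrightarrow> ell2_norm X (A f) \<le> C * ell2_norm X f"
    using bounded_operators_bound[OF A] by blast
  obtain E where E: "finite E" "E \<subseteq> X" and
    tail: "\<And>Y. Y \<subseteq> X \<Longrightarrow> Y \<inter> E = {} \<Longrightarrow> ell2_norm X (\<lambda>x. if x \<in> Y then f x else 0) < \<epsilon> / C"
    using ell2_small_tail[OF f, of "\<epsilon> / C"] \<open>\<epsilon> > 0\<close> \<open>C > 0\<close> by auto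
  have "dist (\<Sum>x\<in>F. f x * A (point_mass x) y) (A f y) < \<epsilon>"
    if F: "finite F" "E \<subseteq> F" "F \<subseteq> X" for F
  proof -
    let ?i = "\<lambda>x. if x \<in> F then f x else 0" and ?o = "\<lambda>x. if x \<in> X - F then f x else 0"
    have o: "?o \<in> ell2 X" by (rule ell2_restrict[OF f])
    have "f = (\<lambda>x. ?i x + ?o x)"
      using ell2_outside[OF f] F by (auto simp: fun_eq_iff)
    then have "A f y = A (\<lambda>x. ?i x + ?o x) y" by simp
    also have "\<dots> = (\<Sum>x\<in>F. f x * A (point_mass x) y) + A ?o y"
      using bounded_operator_finite_support[OF A F(1,3), of f] o
      by (subst bounded_operatorsD(3)[OF A]) auto
    finally have "dist (\<Sum>x\<in>F. f x * A (point_mass x) y) (A f y) = cmod (A ?o y)"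
      by (simp add: dist_norm norm_minus_commute)
    also have "\<dots> \<le> ell2_norm X (A ?o)"
      by (rule cmod_le_ell2_norm) (rule bounded_operatorsD(2)[OF A o])
    also have "\<dots> \<le> C * ell2_norm X ?o" by (rule C(2)[OF o])
    also have "\<dots> < C * (\<epsilon> / C)"
      using C(1) by (intro mult_strict_left_mono tail) (use F in auto)
    also have "\<dots> = \<epsilon>" using C(1) by simp
    finally show ?thesis .
  qed
  then show "\<forall>\<^sub>F F in finite_subsets_at_top X.
      dist (\<Sum>x\<in>F. f x * A (point_mass x) y) (A f y) < \<epsilon>"
    unfolding eventually_finite_subsets_at_top using E by blast
qed

text \<open>On the indicator function of \<open>n\<close> points of \<open>Z\<close> the coordinate \<open>y\<close> of \<open>A\<close> is \<open>n c\<close>, whereas the norm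
  of that function is only \<open>\<surd>n\<close>.\<close>

lemma bounded_operator_constant_row_imp_zero:
  assumes A: "A \<in> bounded_operators X" and "infinite Z" "Z \<subseteq> X"
    and c: "\<And>x. x \<in> Z \<Longrightarrow> A (point_mass x) y = c"
  shows "c = 0"
proof (rule ccontr)
  assume "c \<noteq> 0"
  obtain C where C: "C > 0" "\<And>f. f \<in> ell2 X \<Longrightarrow> ell2_norm X (A f) \<le> C * ell2_norm X f"
    using bounded_operators_bound[OF A] by blast
  obtain n :: nat where n: "C\<^sup>2 < of_nat n * (cmod c)\<^sup>2"
    using \<open>c \<noteq> 0\<close> by (metis ex_less_of_nat_mult zero_less_norm_iff zero_less_power)
  then have "n > 0" by (cases n) auto
  obtain E where E: "E \<subseteq> Z" "finite E" "card E = n"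
    using \<open>infinite Z\<close> by (meson infinite_arbitrarily_large)
  have EX: "E \<subseteq> X" using E assms(3) by blast
  let ?f = "\<lambda>x. if x \<in> E then 1 else 0 :: complex"
  have f: "?f \<in> ell2 X" "A ?f y = (\<Sum>x\<in>E. 1 * A (point_mass x) y)"
    using bounded_operator_finite_support[OF A E(2) EX, of "\<lambda>_. 1"] by auto
  have "A ?f y = of_nat n * c"
    using c E f(2) by (simp add: subset_iff)
  then have "(of_nat n * cmod c)\<^sup>2 = (cmod (A ?f y))\<^sup>2"
    by (simp add: norm_mult)
  also have "\<dots> \<le> (C * ell2_norm X ?f)\<^sup>2"
    using cmod_le_ell2_norm[OF bounded_operatorsD(2)[OF A f(1)], of y] C(2)[OF f(1)]
    by (intro power_mono) auto
  also have "\<dots> = C\<^sup>2 * of_nat n"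
    unfolding power_mult_distrib ell2_norm_restrict[OF EX] using E by simp
  finally have "of_nat n * (of_nat n * (cmod c)\<^sup>2) \<le> of_nat n * C\<^sup>2"
    by (simp add: power_mult_distrib power2_eq_square mult_ac)
  then show False
    using n \<open>n > 0\<close> by simp
qed

lemma bounded_operator_eqI:
  assumes A: "A \<in> bounded_operators X" and B: "B \<in> bounded_operators X"
    and eq: "\<And>x. x \<in> X \<Longrightarrow> A (point_mass x) = B (point_mass x)"
  shows "A = B"
proof
  fix f
  show "A f = B f"
  proof (cases "f \<in> ell2 X")
    case True
    show ?thesis
    proof
      fix y
      have "((\<lambda>x. f x * A (point_mass x) y) has_sum B f y) X"
        using bounded_operator_matrix[OF B True, of y] eq by (simp cong: has_sum_cong)
      then show "A f y = B f y"
        using bounded_operator_matrix[OF A True, of y] has_sum_unique by blast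
    qed
  qed (use bounded_operatorsD(1)[OF A] bounded_operatorsD(1)[OF B] in simp)
qed

section \<open>Operators that permute coordinates\<close>

text \<open>Every operator that is written down explicitly below, whether a regular representation
  operator, a projection onto the functions supported in a subset, or a partial isometry between
  two such subspaces, has this form.\<close>

definition partial_shift :: "'a set \<Rightarrow> 'a set \<Rightarrow> ('a \<Rightarrow> 'a) \<Rightarrow> 'a operator" where
  "partial_shift X Y \<phi> = operator_on X (\<lambda>f x. if x \<in> Y then f (\<phi> x) else 0)"

abbreviation restriction :: "'a set \<Rightarrow> 'a set \<Rightarrow> 'a operator" where
  "restriction X Y \<equiv> partial_shift X Y (\<lambda>x. x)"

lemma partial_shift_apply:
  "f \<in> ell2 X \<Longrightarrow> partial_shift X Y \<phi> f = (\<lambda>x. if x \<in> Y then f (\<phi> x) else 0)"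
  by (simp add: partial_shift_def operator_on_def)

lemma partial_shift_cong:
  "Y = Y' \<Longrightarrow> (\<And>x. x \<in> Y' \<Longrightarrow> \<phi> x = \<phi>' x) \<Longrightarrow> partial_shift X Y \<phi> = partial_shift X Y' \<phi>'"
  by (auto simp: partial_shift_def operator_on_def fun_eq_iff)

lemma partial_shift_contraction:
  assumes "Y \<subseteq> X" "inj_on \<phi> Y" "\<phi> ` Y \<subseteq> X" "f \<in> ell2 X"
  shows "(\<lambda>x. if x \<in> Y then f (\<phi> x) else 0) \<in> ell2 X"
    and "ell2_norm X (\<lambda>x. if x \<in> Y then f (\<phi> x) else 0) \<le> ell2_norm X f"
proof -
  let ?h = "\<lambda>x. if x \<in> Y then f (\<phi> x) else 0"
  have "(\<lambda>x. (cmod (f x))\<^sup>2) summable_on \<phi> ` Y"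
    by (rule ell2_summable_on[OF assms(4,3)])
  then have "(\<lambda>x. (cmod (f (\<phi> x)))\<^sup>2) summable_on Y"
    by (subst (asm) summable_on_reindex[OF assms(2)]) (simp add: o_def)
  moreover have "(\<lambda>x. (cmod (f (\<phi> x)))\<^sup>2) summable_on Y \<longleftrightarrow> (\<lambda>x. (cmod (?h x))\<^sup>2) summable_on X"
    by (rule summable_on_cong_neutral) (use assms(1) in auto)
  ultimately show "?h \<in> ell2 X"
    using assms(1) by (auto simp: ell2_def)
  have "(ell2_norm X ?h)\<^sup>2 = (\<Sum>\<^sub>\<infinity>x\<in>Y. (cmod (f (\<phi> x)))\<^sup>2)"
    unfolding ell2_norm_square by (rule infsum_cong_neutral) (use assms(1) in auto)
  also have "\<dots> = (\<Sum>\<^sub>\<infinity>x\<in>\<phi> ` Y. (cmod (f x))\<^sup>2)"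
    by (subst infsum_reindex[OF assms(2)]) (simp add: o_def)
  also have "\<dots> \<le> (\<Sum>\<^sub>\<infinity>x\<in>X. (cmod (f x))\<^sup>2)"
    by (rule infsum_mono2) (use assms ell2_summable_on[OF assms(4)] in auto)
  finally show "ell2_norm X ?h \<le> ell2_norm X f"
    unfolding ell2_norm_square[symmetric] using ell2_norm_nonneg power2_le_imp_le by blast
qed

lemma partial_shift_bounded:
  assumes "Y \<subseteq> X" "inj_on \<phi> Y" "\<phi> ` Y \<subseteq> X"
  shows "partial_shift X Y \<phi> \<in> bounded_operators X"
proof -
  have "\<forall>f\<in>ell2 X. ell2_norm X (partial_shift X Y \<phi> f) \<le> 1 * ell2_norm X f"
    using partial_shift_contraction(2)[OF assms] by (simp add: partial_shift_apply)
  then have "\<exists>C. \<forall>f\<in>ell2 X. ell2_norm X (partial_shift X Y \<phi> f) \<le> C * ell2_norm X f"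
    by blast
  then show ?thesis
    unfolding bounded_operators_def
    using partial_shift_contraction(1)[OF assms] ell2_add[of _ X] ell2_scale[of _ X]
    by (auto simp: partial_shift_apply partial_shift_def[of X Y \<phi>] operator_on_def fun_eq_iff)
qed

lemma restriction_bounded: "Y \<subseteq> X \<Longrightarrow> restriction X Y \<in> bounded_operators X"
  by (rule partial_shift_bounded) auto

lemma partial_shift_comp:
  assumes "Y' \<subseteq> X" "inj_on \<phi>' Y'" "\<phi>' ` Y' \<subseteq> X"
  shows "partial_shift X Y \<phi> \<circ> partial_shift X Y' \<phi>'
    = partial_shift X {x \<in> Y. \<phi> x \<in> Y'} (\<lambda>x. \<phi>' (\<phi> x))"
proof -
  have "partial_shift X Y \<phi> (\<lambda>_. 0) = (\<lambda>_. 0)"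
    by (simp add: partial_shift_apply)
  then show ?thesis
    using partial_shift_contraction(1)[OF assms]
    by (auto simp: fun_eq_iff partial_shift_def operator_on_def)
qed

lemma restriction_comp:
  "Y' \<subseteq> X \<Longrightarrow> restriction X Y \<circ> restriction X Y' = restriction X (Y \<inter> Y')"
  by (subst partial_shift_comp) (auto simp: Int_def intro: partial_shift_cong)

lemma restriction_empty: "restriction X {} = (\<lambda>_ _. 0)"
  by (auto simp: partial_shift_def operator_on_def fun_eq_iff)

lemma partial_shift_adjoint:
  assumes "Y \<subseteq> X" "Y' \<subseteq> X" "bij_betw \<phi> Y Y'" "\<And>x. x \<in> Y \<Longrightarrow> \<psi> (\<phi> x) = x"
  shows "is_adjoint X (partial_shift X Y \<phi>) (partial_shift X Y' \<psi>)"
  unfolding is_adjoint_def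
proof (intro ballI)
  fix f g :: "'a \<Rightarrow> complex" assume fg: "f \<in> ell2 X" "g \<in> ell2 X"
  have "ell2_inner X (partial_shift X Y \<phi> f) g = (\<Sum>\<^sub>\<infinity>x\<in>Y. f (\<phi> x) * cnj (g (\<psi> (\<phi> x))))"
    unfolding ell2_inner_def partial_shift_apply[OF fg(1)]
    by (rule infsum_cong_neutral) (use assms in auto)
  also have "\<dots> = (\<Sum>\<^sub>\<infinity>x\<in>Y'. f x * cnj (g (\<psi> x)))"
    by (rule infsum_reindex_bij_betw[OF assms(3)])
  also have "\<dots> = ell2_inner X f (partial_shift X Y' \<psi> g)"
    unfolding ell2_inner_def partial_shift_apply[OF fg(2)]
    by (rule infsum_cong_neutral) (use assms in auto)
  finally show "ell2_inner X (partial_shift X Y \<phi> f) g = ell2_inner X f (partial_shift X Y' \<psi> g)" .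
qed

lemma restriction_projection: "Y \<subseteq> X \<Longrightarrow> is_projection X (restriction X Y)"
  unfolding is_projection_def
  by (auto simp: restriction_bounded restriction_comp bij_betw_def intro!: partial_shift_adjoint)

lemma restriction_point_mass:
  "x \<in> X \<Longrightarrow> restriction X Y (point_mass x) = (if x \<in> Y then point_mass x else (\<lambda>_. 0))"
  by (auto simp: partial_shift_apply point_mass_ell2)

section \<open>Commutants\<close>

lemma commutant_comp:
  assumes "A \<in> commutant X S" "B \<in> commutant X S" shows "A \<circ> B \<in> commutant X S"
proof -
  have "A \<circ> B \<circ> C = C \<circ> (A \<circ> B)" if "C \<in> S" for C
  proof -
    have "A \<circ> B \<circ> C = A \<circ> (C \<circ> B)"
      using assms that by (simp add: commutant_def o_assoc[symmetric])
    then show ?thesis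
      using assms that by (simp add: commutant_def o_assoc)
  qed
  then show ?thesis
    using assms by (simp add: commutant_def bounded_operators_comp)
qed

lemma double_commutant_superset:
  assumes "S \<subseteq> bounded_operators X" shows "S \<subseteq> commutant X (commutant X S)"
  using assms unfolding commutant_def by auto

lemma triple_commutant:
  assumes "S \<subseteq> bounded_operators X"
  shows "commutant X (commutant X (commutant X S)) = commutant X S"
proof -
  have "commutant X S \<subseteq> bounded_operators X"
    by (simp add: commutant_def)
  then have "commutant X S \<subseteq> commutant X (commutant X (commutant X S))"
    by (rule double_commutant_superset)
  moreover have "commutant X (commutant X (commutant X S)) \<subseteq> commutant X S"
    using double_commutant_superset[OF assms] unfolding commutant_def by blast
  ultimately show ?thesis by blast
qed

section \<open>Abelian subgroups with infinitely many free double cosets\<close>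

locale torsion_free_abelian_subgroup = group G for G (structure) +
  fixes H
  assumes subgroup_H: "subgroup H G"
    and H_commute: "\<And>h k. h \<in> H \<Longrightarrow> k \<in> H \<Longrightarrow> h \<otimes> k = k \<otimes> h"
    and H_torsion_free: "\<And>h n. h \<in> H \<Longrightarrow> h [^] (n::nat) = \<one> \<Longrightarrow> n > 0 \<Longrightarrow> h = \<one>"
    and H_nontrivial: "H \<noteq> {\<one>}"
begin

abbreviation X where "X \<equiv> carrier G"

text \<open>As \<open>H\<close> is abelian, the right translations may be composed in either order, so this is an action of
  the group \<open>H \<times> H\<close>. Its orbits are the double cosets of \<open>H\<close>.\<close>

definition act where "act h k x = h \<otimes> x \<otimes> k"

definition orbit where "orbit x = (\<lambda>(h, k). act h k x) ` (H \<times> H)"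

definition free_points where
  "free_points = {x \<in> X. \<forall>h\<in>H. \<forall>k\<in>H. act h k x = x \<longrightarrow> h = \<one> \<and> k = \<one>}"

abbreviation H_shifts where "H_shifts \<equiv> left_regular G ` H \<union> right_regular G ` H"

abbreviation K where "K \<equiv> commutant X H_shifts"

lemma H_closed [simp]: "h \<in> H \<Longrightarrow> h \<in> X"
  using subgroup.mem_carrier[OF subgroup_H] .

lemma H_mult [simp]: "h \<in> H \<Longrightarrow> k \<in> H \<Longrightarrow> h \<otimes> k \<in> H"
  using subgroup.m_closed[OF subgroup_H] .

lemma H_inv [simp]: "h \<in> H \<Longrightarrow> inv h \<in> H"
  using subgroup.m_inv_closed[OF subgroup_H] .

lemma H_one [simp]: "\<one> \<in> H"
  using subgroup.one_closed[OF subgroup_H] .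

lemma H_pow [simp]: "h \<in> H \<Longrightarrow> h [^] (n::nat) \<in> H"
  by (induction n) auto

lemma act_closed [simp]: "h \<in> H \<Longrightarrow> k \<in> H \<Longrightarrow> x \<in> X \<Longrightarrow> act h k x \<in> X"
  by (simp add: act_def)

lemma act_one [simp]: "x \<in> X \<Longrightarrow> act \<one> \<one> x = x"
  by (simp add: act_def)

lemma act_act:
  assumes "h \<in> H" "k \<in> H" "h' \<in> H" "k' \<in> H" "x \<in> X"
  shows "act h k (act h' k' x) = act (h \<otimes> h') (k \<otimes> k') x"
proof -
  have "act h k (act h' k' x) = h \<otimes> h' \<otimes> x \<otimes> (k' \<otimes> k)"
    using assms by (simp add: act_def m_assoc)
  also have "k' \<otimes> k = k \<otimes> k'"
    using assms H_commute by blast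
  finally show ?thesis by (simp add: act_def)
qed

lemma act_inv_act [simp]:
  assumes "h \<in> H" "k \<in> H" "x \<in> X"
  shows "act (inv h) (inv k) (act h k x) = x" "act h k (act (inv h) (inv k) x) = x"
  using assms by (simp_all add: act_act)

lemma act_eq_iff [simp]:
  assumes "h \<in> H" "k \<in> H" "x \<in> X" "y \<in> X"
  shows "act h k x = act h k y \<longleftrightarrow> x = y"
  using assms act_inv_act(1) by metis

lemma orbit_self [simp]: "x \<in> X \<Longrightarrow> x \<in> orbit x"
  unfolding orbit_def by (rule image_eqI[of _ _ "(\<one>, \<one>)"]) auto

lemma orbit_subset: "x \<in> X \<Longrightarrow> orbit x \<subseteq> X"
  by (auto simp: orbit_def)

lemma act_in_orbit: "h \<in> H \<Longrightarrow> k \<in> H \<Longrightarrow> act h k x \<in> orbit x"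
  by (auto simp: orbit_def)

lemma in_orbitE:
  assumes "y \<in> orbit x" obtains h k where "h \<in> H" "k \<in> H" "y = act h k x"
  using assms by (auto simp: orbit_def)

lemma orbit_eq:
  assumes "x \<in> X" "y \<in> orbit x" shows "orbit y = orbit x"
proof -
  have sub: "orbit b \<subseteq> orbit a" if "a \<in> X" "b \<in> orbit a" for a b
    using that by (auto elim!: in_orbitE simp: act_act act_in_orbit)
  obtain h k where hk: "h \<in> H" "k \<in> H" "y = act h k x" using assms(2) by (rule in_orbitE)
  then have "x = act (inv h) (inv k) y" using assms by simp
  then have "x \<in> orbit y" using act_in_orbit[of "inv h" "inv k" y] hk by simp
  then show ?thesis using sub[of x y] sub[of y x] assms hk by auto
qed

lemma orbit_act_iff:
  assumes "x \<in> X" "y \<in> X" "h \<in> H" "k \<in> H"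
  shows "act h k y \<in> orbit x \<longleftrightarrow> y \<in> orbit x"
proof -
  have "orbit (act h k y) = orbit y"
    using orbit_eq[OF assms(2) act_in_orbit[OF assms(3,4)]] .
  then show ?thesis
    using orbit_eq[of x] assms orbit_self[of "act h k y"] orbit_self[of y]
    by (metis act_closed)
qed

lemma free_points_subset: "free_points \<subseteq> X"
  by (auto simp: free_points_def)

lemma free_pointsD:
  "x \<in> free_points \<Longrightarrow> h \<in> H \<Longrightarrow> k \<in> H \<Longrightarrow> act h k x = x \<Longrightarrow> h = \<one> \<and> k = \<one>"
  by (auto simp: free_points_def)

lemma free_points_act:
  assumes "x \<in> free_points" "h \<in> H" "k \<in> H" shows "act h k x \<in> free_points"
proof -
  have x: "x \<in> X" using assms(1) free_points_subset by blast
  have "h' = \<one> \<and> k' = \<one>" if "h' \<in> H" "k' \<in> H" "act h' k' (act h k x) = act h k x" for h' k'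
  proof -
    have "act h' k' (act h k x) = act h k (act h' k' x)"
      using assms that x by (simp add: act_act H_commute)
    then show ?thesis using free_pointsD[OF assms(1) that(1,2)] assms that x by simp
  qed
  then show ?thesis using assms x by (auto simp: free_points_def)
qed

lemma free_points_act_iff:
  assumes "x \<in> X" "h \<in> H" "k \<in> H"
  shows "act h k x \<in> free_points \<longleftrightarrow> x \<in> free_points"
  using free_points_act[of "act h k x" "inv h" "inv k"] free_points_act[of x h k] assms by auto

lemma orbit_free: "x \<in> free_points \<Longrightarrow> orbit x \<subseteq> free_points"
  by (auto simp: orbit_def free_points_act)

text \<open>Elements of \<open>H\<close> commute with \<open>H\<close>, hence are fixed by every \<open>(h, h\<^sup>-\<^sup>1)\<close>. So the projection onto the
  functions supported in the free points lies below \<open>1 - p\<^sub>1\<close>.\<close>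

lemma free_points_disjoint: "free_points \<inter> H = {}"
proof -
  obtain h where h: "h \<in> H" "h \<noteq> \<one>" using H_nontrivial H_one by blast
  have "act h (inv h) x = x" if "x \<in> H" for x
    using that h by (simp add: act_def H_commute[of h x] m_assoc)
  then show ?thesis using free_pointsD[of _ h "inv h"] h by auto
qed

lemma orbit_bij:
  assumes "x \<in> free_points"
  shows "bij_betw (\<lambda>(h, k). act h k x) (H \<times> H) (orbit x)"
proof -
  have x: "x \<in> X" using assms free_points_subset by blast
  have "h = h' \<and> k = k'"
    if "h \<in> H" "k \<in> H" "h' \<in> H" "k' \<in> H" and eq: "act h k x = act h' k' x" for h k h' k'
  proof -
    have "act (inv h' \<otimes> h) (inv k' \<otimes> k) x = act (inv h') (inv k') (act h k x)"
      using that(1-4) x by (simp add: act_act)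
    also have "\<dots> = x" unfolding eq using that(1-4) x by simp
    finally have "inv h' \<otimes> h = \<one> \<and> inv k' \<otimes> k = \<one>"
      using free_pointsD[OF assms, of "inv h' \<otimes> h" "inv k' \<otimes> k"] that by simp
    then show ?thesis using that by (metis H_closed H_inv inv_equality inv_inv)
  qed
  then show ?thesis by (auto simp: bij_betw_def inj_on_def orbit_def)
qed

lemma act_pow_fixed:
  assumes "x \<in> X" "h \<in> H" "k \<in> H" "act h k x = x"
  shows "act (h [^] (n::nat)) (k [^] n) x = x"
proof (induction n)
  case (Suc n)
  have "act (h [^] n \<otimes> h) (k [^] n \<otimes> k) x = act (h [^] n) (k [^] n) (act h k x)"
    using assms(1-3) by (simp add: act_act)
  then show ?case using assms Suc by simp
qed (use assms in simp)

text \<open>This is where the absence of torsion enters: the stabiliser of a free point contains no power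
  \<open>(h\<^sup>d, k\<^sup>d)\<close> with \<open>d > 0\<close>.\<close>

lemma infinite_orbit:
  assumes x: "x \<in> free_points" and hk: "h \<in> H" "k \<in> H" "h \<noteq> \<one> \<or> k \<noteq> \<one>"
  shows "infinite (range (\<lambda>n::nat. act (h [^] n) (k [^] n) x))"
proof -
  have X: "x \<in> X" using x free_points_subset by blast
  have neq: "act (h [^] m) (k [^] m) x \<noteq> act (h [^] n) (k [^] n) x" if "m < n" for m n :: nat
  proof
    assume eq: "act (h [^] m) (k [^] m) x = act (h [^] n) (k [^] n) x"
    define d where "d = n - m"
    have n: "n = m + d" "d > 0" using that by (auto simp: d_def)
    have "act (h [^] m) (k [^] m) (act (h [^] d) (k [^] d) x) = act (h [^] m) (k [^] m) x"
      using hk X eq by (simp add: act_act n nat_pow_mult)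
    then have "act (h [^] d) (k [^] d) x = x" using hk X by simp
    then have "h [^] d = \<one> \<and> k [^] d = \<one>" using free_pointsD[OF x, of "h [^] d" "k [^] d"] hk by simp
    then show False using H_torsion_free n(2) hk by blast
  qed
  have "inj (\<lambda>n::nat. act (h [^] n) (k [^] n) x)"
    unfolding inj_def by (metis neq linorder_neqE_nat)
  then show ?thesis by (rule range_inj_infinite)
qed

subsection \<open>The commutant of the translations\<close>

lemma left_regular_eq: "left_regular G h = partial_shift X X (\<lambda>x. inv h \<otimes> x)"
  and right_regular_eq: "right_regular G h = partial_shift X X (\<lambda>x. x \<otimes> inv h)"
  by (simp_all add: left_regular_def right_regular_def partial_shift_def)

lemma translations_bounded: "H_shifts \<subseteq> bounded_operators X"
proof -
  have "left_regular G h \<in> bounded_operators X" "right_regular G h \<in> bounded_operators X"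
    if "h \<in> H" for h
    unfolding left_regular_eq right_regular_eq
    using that by (auto intro!: partial_shift_bounded simp: inj_on_def)
  then show ?thesis by blast
qed

lemma commutant_left_right_algebra: "commutant X (left_right_algebra G H) = K"
  unfolding left_right_algebra_def by (rule triple_commutant) (rule translations_bounded)

lemma K_bounded: "A \<in> K \<Longrightarrow> A \<in> bounded_operators X"
  by (simp add: commutant_def)

lemma K_coefficient:
  assumes A: "A \<in> K" and "h \<in> H" "k \<in> H" "x \<in> X" "y \<in> X"
  shows "A (point_mass (act h k x)) (act h k y) = A (point_mass x) y"
proof -
  have L: "A (left_regular G h f) = left_regular G h (A f)"
    and R: "A (right_regular G k f) = right_regular G k (A f)" for f
    using A assms(2,3) by (auto simp: commutant_def fun_eq_iff)
  have ell2: "point_mass (h \<otimes> x) \<in> ell2 X" "point_mass x \<in> ell2 X"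
    using assms by (auto intro: point_mass_ell2)
  have "A (point_mass (act h k x)) (act h k y)
      = right_regular G k (A (point_mass (h \<otimes> x))) (h \<otimes> y \<otimes> k)"
    using assms R[of "point_mass (h \<otimes> x)"]
    by (simp add: act_def right_regular_point_mass[OF group_axioms])
  also have "\<dots> = A (point_mass (h \<otimes> x)) (h \<otimes> y)"
    using assms ell2 bounded_operatorsD(2)[OF K_bounded[OF A]]
    by (simp add: right_regular_eq partial_shift_apply m_assoc)
  also have "\<dots> = left_regular G h (A (point_mass x)) (h \<otimes> y)"
    using assms L[of "point_mass x"] by (simp add: left_regular_point_mass[OF group_axioms])
  also have "\<dots> = A (point_mass x) y"
    using assms ell2 bounded_operatorsD(2)[OF K_bounded[OF A]]
    by (simp add: left_regular_eq partial_shift_apply m_assoc[symmetric])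
  finally show ?thesis .
qed

lemma partial_shift_in_K:
  assumes Y: "Y \<subseteq> X" "inj_on \<phi> Y" "\<phi> ` Y \<subseteq> X"
    and act_Y: "\<And>h k x. h \<in> H \<Longrightarrow> k \<in> H \<Longrightarrow> x \<in> X \<Longrightarrow> act h k x \<in> Y \<longleftrightarrow> x \<in> Y"
    and act_\<phi>: "\<And>h k x. h \<in> H \<Longrightarrow> k \<in> H \<Longrightarrow> x \<in> Y \<Longrightarrow> \<phi> (act h k x) = act h k (\<phi> x)"
  shows "partial_shift X Y \<phi> \<in> K"
proof -
  let ?A = "partial_shift X Y \<phi>"
  have comm: "?A \<circ> partial_shift X X (act h k) = partial_shift X X (act h k) \<circ> ?A"
    if hk: "h \<in> H" "k \<in> H" for h k
  proof -
    have "?A \<circ> partial_shift X X (act h k) = partial_shift X {x \<in> Y. \<phi> x \<in> X} (\<lambda>x. act h k (\<phi> x))"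
      using hk by (intro partial_shift_comp) (auto simp: inj_on_def)
    also have "\<dots> = partial_shift X {x \<in> X. act h k x \<in> Y} (\<lambda>x. \<phi> (act h k x))"
      by (rule partial_shift_cong) (use hk Y act_Y act_\<phi> in auto)
    also have "\<dots> = partial_shift X X (act h k) \<circ> ?A"
      using Y by (intro partial_shift_comp[symmetric])
    finally show ?thesis .
  qed
  have "left_regular G h = partial_shift X X (act (inv h) \<one>)"
    "right_regular G h = partial_shift X X (act \<one> (inv h))" if "h \<in> H" for h
    unfolding left_regular_eq right_regular_eq
    using that by (auto intro!: partial_shift_cong simp: act_def)
  then show ?thesis
    using comm partial_shift_bounded[OF Y] by (auto simp: commutant_def)
qed

lemma restriction_in_K:
  assumes "Y \<subseteq> X" "\<And>h k x. h \<in> H \<Longrightarrow> k \<in> H \<Longrightarrow> x \<in> X \<Longrightarrow> act h k x \<in> Y \<longleftrightarrow> x \<in> Y"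
  shows "restriction X Y \<in> K"
  by (rule partial_shift_in_K) (use assms in auto)

lemma restriction_free_in_K: "restriction X free_points \<in> K"
  by (rule restriction_in_K) (use free_points_subset free_points_act_iff in auto)

lemma restriction_orbit_in_K: "x \<in> X \<Longrightarrow> restriction X (orbit x) \<in> K"
  by (rule restriction_in_K) (use orbit_subset orbit_act_iff in auto)

text \<open>A point that is not free is fixed by some \<open>(h, k) \<noteq> (1, 1)\<close>. The powers of \<open>(h, k)\<close> move a free
  point through infinitely many points, and the coefficients of \<open>A\<close> along this orbit are all equal.
  So they vanish, by square-summability of a column in one direction and by boundedness of a row in
  the other. This says that the functions supported in the free points carry a
  representation of \<open>H \<times> H\<close> that is disjoint from the one on the remaining functions.\<close>

lemma K_coefficient_free_nonfree:
  assumes A: "A \<in> K" and x: "x \<in> free_points" and y: "y \<in> X" "y \<notin> free_points"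
  shows "A (point_mass x) y = 0" and "A (point_mass y) x = 0"
proof -
  have X: "x \<in> X" using x free_points_subset by blast
  obtain h k where hk: "h \<in> H" "k \<in> H" "act h k y = y" "h \<noteq> \<one> \<or> k \<noteq> \<one>"
    using y by (auto simp: free_points_def)
  define Z where "Z = range (\<lambda>n::nat. act (h [^] n) (k [^] n) x)"
  have Z: "infinite Z" "Z \<subseteq> X"
    unfolding Z_def using infinite_orbit[OF x hk(1,2,4)] hk X by auto
  have y_fixed: "act (h [^] n) (k [^] n) y = y" for n :: nat
    using act_pow_fixed y(1) hk by blast
  have row: "A (point_mass z) y = A (point_mass x) y"
    and column: "A (point_mass y) z = A (point_mass y) x" if z_Z: "z \<in> Z" for z
  proof -
    obtain n :: nat where z: "z = act (h [^] n) (k [^] n) x" using z_Z unfolding Z_def by blast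
    show "A (point_mass z) y = A (point_mass x) y"
      using K_coefficient[OF A, of "h [^] n" "k [^] n" x y] hk X y y_fixed z by simp
    show "A (point_mass y) z = A (point_mass y) x"
      using K_coefficient[OF A, of "h [^] n" "k [^] n" y x] hk X y y_fixed z by simp
  qed
  show "A (point_mass x) y = 0"
    by (rule bounded_operator_constant_row_imp_zero[OF K_bounded[OF A] Z]) (rule row)
  have "A (point_mass y) \<in> ell2 X"
    using bounded_operatorsD(2)[OF K_bounded[OF A] point_mass_ell2[OF y(1)]] .
  then show "A (point_mass y) x = 0"
    by (rule ell2_constant_on_infinite_imp_zero[OF _ Z]) (rule column)
qed

lemma restriction_free_central:
  assumes A: "A \<in> K"
  shows "restriction X free_points \<circ> A = A \<circ> restriction X free_points"
proof (rule bounded_operator_eqI)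
  note z = restriction_bounded[OF free_points_subset]
  show "restriction X free_points \<circ> A \<in> bounded_operators X"
    "A \<circ> restriction X free_points \<in> bounded_operators X"
    by (rule bounded_operators_comp[OF z K_bounded[OF A]] bounded_operators_comp[OF K_bounded[OF A] z])+
  fix x assume x: "x \<in> X"
  have ell2: "A (point_mass x) \<in> ell2 X"
    using bounded_operatorsD(2)[OF K_bounded[OF A] point_mass_ell2[OF x]] .
  have "A (point_mass x) y = 0" if "x \<in> free_points \<longleftrightarrow> y \<notin> free_points" for y
    using K_coefficient_free_nonfree[OF A] x that ell2_outside[OF ell2] by (cases "y \<in> X") auto
  then have "restriction X free_points (A (point_mass x))
      = (if x \<in> free_points then A (point_mass x) else (\<lambda>_. 0))"
    by (auto simp: partial_shift_apply[OF ell2] fun_eq_iff)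
  then show "(restriction X free_points \<circ> A) (point_mass x) = (A \<circ> restriction X free_points) (point_mass x)"
    using x bounded_operatorsD(5)[OF K_bounded[OF A]] by (simp add: restriction_point_mass)
qed

subsection \<open>Corners at free orbits\<close>

text \<open>On a free orbit, identified with \<open>H \<times> H\<close>, the elements of \<open>K\<close> are convolution operators.\<close>

lemma K_coefficient_product:
  assumes A: "A \<in> K" and B: "B \<in> K" and x: "x \<in> free_points"
    and supp: "\<And>y. y \<notin> orbit x \<Longrightarrow> B (point_mass x) y = 0"
    and hk: "h0 \<in> H" "k0 \<in> H"
  shows "A (B (point_mass x)) (act h0 k0 x) = (\<Sum>\<^sub>\<infinity>(h, k)\<in>H \<times> H.
      B (point_mass x) (act h k x) * A (point_mass x) (act (inv h \<otimes> h0) (inv k \<otimes> k0) x))"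
proof -
  have X: "x \<in> X" using x free_points_subset by blast
  let ?y = "act h0 k0 x"
  have "A (B (point_mass x)) ?y = (\<Sum>\<^sub>\<infinity>t\<in>X. B (point_mass x) t * A (point_mass t) ?y)"
    using A B X by (intro infsumI[symmetric] bounded_operator_matrix)
      (auto intro: bounded_operatorsD(2) K_bounded point_mass_ell2)
  also have "\<dots> = (\<Sum>\<^sub>\<infinity>t\<in>orbit x. B (point_mass x) t * A (point_mass t) ?y)"
    by (rule infsum_cong_neutral) (use supp orbit_subset[OF X] in auto)
  also have "\<dots> = (\<Sum>\<^sub>\<infinity>p\<in>H \<times> H. B (point_mass x) ((\<lambda>(h, k). act h k x) p)
      * A (point_mass ((\<lambda>(h, k). act h k x) p)) ?y)"
    by (rule infsum_reindex_bij_betw[OF orbit_bij[OF x], symmetric])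
  also have "\<dots> = (\<Sum>\<^sub>\<infinity>(h, k)\<in>H \<times> H.
      B (point_mass x) (act h k x) * A (point_mass x) (act (inv h \<otimes> h0) (inv k \<otimes> k0) x))"
  proof (rule infsum_cong, clarify)
    fix h k assume "h \<in> H" "k \<in> H"
    moreover from this have "?y = act h k (act (inv h \<otimes> h0) (inv k \<otimes> k0) x)"
      using hk X by (simp add: act_act m_assoc[symmetric])
    ultimately show "B (point_mass x) (act h k x) * A (point_mass (act h k x)) ?y
        = B (point_mass x) (act h k x) * A (point_mass x) (act (inv h \<otimes> h0) (inv k \<otimes> k0) x)"
      using K_coefficient[OF A] hk X by simp
  qed
  finally show ?thesis .
qed

text \<open>The coefficient at \<open>h\<^sub>0 x k\<^sub>0\<close> is the convolution of those of \<open>A\<close> and \<open>B\<close>, and the substitution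
  \<open>(h, k) \<mapsto> (h\<^sup>-\<^sup>1 h\<^sub>0, k\<^sup>-\<^sup>1 k\<^sub>0)\<close> exchanges the two factors.\<close>

lemma K_commute_on_orbit:
  assumes A: "A \<in> K" and B: "B \<in> K" and x: "x \<in> free_points"
    and suppA: "\<And>y. y \<notin> orbit x \<Longrightarrow> A (point_mass x) y = 0"
    and suppB: "\<And>y. y \<notin> orbit x \<Longrightarrow> B (point_mass x) y = 0"
    and hk: "h0 \<in> H" "k0 \<in> H"
  shows "A (B (point_mass x)) (act h0 k0 x) = B (A (point_mass x)) (act h0 k0 x)"
proof -
  let ?\<tau> = "\<lambda>(h, k). (inv h \<otimes> h0, inv k \<otimes> k0)"
  let ?a = "\<lambda>p. A (point_mass x) (act (fst p) (snd p) x)"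
  let ?b = "\<lambda>p. B (point_mass x) (act (fst p) (snd p) x)"
  have "inv (inv h \<otimes> g) \<otimes> g = h" if "h \<in> H" "g \<in> H" for h g
  proof -
    have "inv (inv h \<otimes> g) \<otimes> g = inv g \<otimes> (g \<otimes> h)"
      using that H_commute[of h g] by (simp add: inv_mult_group m_assoc)
    then show ?thesis using that by (simp add: m_assoc[symmetric])
  qed
  then have \<tau>: "?\<tau> (?\<tau> p) = p" "?\<tau> p \<in> H \<times> H" if "p \<in> H \<times> H" for p
    using that hk by auto
  have bij: "bij_betw ?\<tau> (H \<times> H) (H \<times> H)"
    by (rule bij_betw_byWitness[of _ ?\<tau>]) (use \<tau> in blast)+
  have "A (B (point_mass x)) (act h0 k0 x) = (\<Sum>\<^sub>\<infinity>p\<in>H \<times> H. ?b p * ?a (?\<tau> p))"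
    using K_coefficient_product[OF A B x suppB hk] by (simp add: case_prod_unfold)
  also have "\<dots> = (\<Sum>\<^sub>\<infinity>p\<in>H \<times> H. ?b (?\<tau> p) * ?a (?\<tau> (?\<tau> p)))"
    by (rule infsum_reindex_bij_betw[OF bij, symmetric])
  also have "\<dots> = (\<Sum>\<^sub>\<infinity>p\<in>H \<times> H. ?a p * ?b (?\<tau> p))"
  proof (rule infsum_cong)
    fix p assume "p \<in> H \<times> H"
    then have "?\<tau> (?\<tau> p) = p" by (rule \<tau>(1))
    then show "?b (?\<tau> p) * ?a (?\<tau> (?\<tau> p)) = ?a p * ?b (?\<tau> p)" by simp
  qed
  also have "\<dots> = B (A (point_mass x)) (act h0 k0 x)"
    using K_coefficient_product[OF B A x suppA hk] by (simp add: case_prod_unfold)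
  finally show ?thesis .
qed

text \<open>Any point of the orbit can serve as its base point, so the previous lemma gives all matrix
  coefficients of the two products.\<close>

lemma corner_commute:
  assumes A: "A \<in> K" and B: "B \<in> K" and x0: "x0 \<in> free_points"
  defines "e \<equiv> restriction X (orbit x0)"
  shows "(e \<circ> A \<circ> e) \<circ> (e \<circ> B \<circ> e) = (e \<circ> B \<circ> e) \<circ> (e \<circ> A \<circ> e)"
proof -
  have x0X: "x0 \<in> X" using x0 free_points_subset by blast
  have e: "e \<in> K" unfolding e_def by (rule restriction_orbit_in_K[OF x0X])
  define D where "D A = e \<circ> A \<circ> e" for A
  have D: "D A \<in> K" if "A \<in> K" for A
    unfolding D_def using that e by (intro commutant_comp)
  have out: "D A f y = 0" if "A \<in> K" "y \<notin> orbit x0" for A f y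
  proof -
    have "D A f = e ((A \<circ> e) f)" by (simp add: D_def)
    then show ?thesis
      using that(2) by (auto simp: e_def partial_shift_def operator_on_def)
  qed
  have zero: "D A (point_mass x) = (\<lambda>_. 0)" if "A \<in> K" "x \<in> X" "x \<notin> orbit x0" for A x
    using that bounded_operatorsD(5)[OF K_bounded] e
    by (simp add: D_def e_def restriction_point_mass)
  have "D A \<circ> D B = D B \<circ> D A"
  proof (rule bounded_operator_eqI)
    show "D A \<circ> D B \<in> bounded_operators X" "D B \<circ> D A \<in> bounded_operators X"
      using A B D by (blast intro: K_bounded bounded_operators_comp)+
    fix x assume x: "x \<in> X"
    show "(D A \<circ> D B) (point_mass x) = (D B \<circ> D A) (point_mass x)"
    proof (cases "x \<in> orbit x0")
      case True
      then have x_free: "x \<in> free_points" and orb: "orbit x = orbit x0"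
        using orbit_free[OF x0] orbit_eq[OF x0X] by auto
      show ?thesis
      proof
        fix y
        show "(D A \<circ> D B) (point_mass x) y = (D B \<circ> D A) (point_mass x) y"
        proof (cases "y \<in> orbit x")
          case True
          then obtain h k where "h \<in> H" "k \<in> H" "y = act h k x" by (rule in_orbitE)
          then show ?thesis
            using K_commute_on_orbit[OF D[OF A] D[OF B] x_free] out[OF A] out[OF B] orb by simp
        next
          case False
          then show ?thesis using out[OF A] out[OF B] orb by simp
        qed
      qed
    next
      case False
      then show ?thesis
        using zero[OF A x] zero[OF B x] bounded_operatorsD(5)[OF K_bounded[OF D[OF A]]]
          bounded_operatorsD(5)[OF K_bounded[OF D[OF B]]] by simp
    qed
  qed
  then show ?thesis by (simp add: D_def)
qed

text \<open>The map \<open>h x k \<mapsto> h y k\<close>. It is well defined on the orbit of a free point \<open>x\<close>.\<close>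

definition transport where
  "transport x y t = (case inv_into (H \<times> H) (\<lambda>(h, k). act h k x) t of (h, k) \<Rightarrow> act h k y)"

lemma transport_act:
  assumes "x \<in> free_points" "h \<in> H" "k \<in> H"
  shows "transport x y (act h k x) = act h k y"
proof -
  have "inv_into (H \<times> H) (\<lambda>(h, k). act h k x) ((\<lambda>(h, k). act h k x) (h, k)) = (h, k)"
    using orbit_bij[OF assms(1)] assms by (intro inv_into_f_f) (auto simp: bij_betw_def)
  then show ?thesis by (simp add: transport_def)
qed

lemma transport_inverse:
  assumes "x \<in> free_points" "y \<in> free_points" "t \<in> orbit x"
  shows "transport x y t \<in> orbit y" "transport y x (transport x y t) = t"
  using assms by (auto elim!: in_orbitE simp: transport_act act_in_orbit)

lemma transport_bij:
  assumes "x \<in> free_points" "y \<in> free_points"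
  shows "bij_betw (transport x y) (orbit x) (orbit y)"
  by (rule bij_betw_byWitness[of _ "transport y x"])
    (use transport_inverse assms in auto)

lemma orbits_equivalent:
  assumes x: "x \<in> free_points" and y: "y \<in> free_points"
  obtains v w where "v \<in> K" "w \<in> K" "is_adjoint X v w"
    "w \<circ> v = restriction X (orbit x)" "v \<circ> w = restriction X (orbit y)"
    "v \<circ> restriction X (orbit x) = v" "w \<circ> restriction X (orbit y) = w"
proof -
  have shift: "partial_shift X (orbit x) (transport x y) \<in> K
      \<and> partial_shift X (orbit y) (transport y x) \<circ> partial_shift X (orbit x) (transport x y)
        = restriction X (orbit y)
      \<and> partial_shift X (orbit x) (transport x y) \<circ> restriction X (orbit y)
        = partial_shift X (orbit x) (transport x y)"
    if x: "x \<in> free_points" and y: "y \<in> free_points" for x y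
  proof -
    have X: "x \<in> X" "y \<in> X" using x y free_points_subset by auto
    have t: "inj_on (transport x y) (orbit x)" "transport x y ` orbit x \<subseteq> X"
      using transport_bij[OF x y] orbit_subset[OF X(2)] by (auto simp: bij_betw_def)
    have "partial_shift X (orbit x) (transport x y) \<in> K"
    proof (rule partial_shift_in_K[OF orbit_subset[OF X(1)] t])
      fix h k z assume hk: "h \<in> H" "k \<in> H" and "z \<in> orbit x"
      then obtain h' k' where "h' \<in> H" "k' \<in> H" "z = act h' k' x" by (elim in_orbitE)
      then show "transport x y (act h k z) = act h k (transport x y z)"
        using hk X x by (simp add: act_act transport_act)
    qed (use orbit_act_iff X in auto)
    moreover have "partial_shift X (orbit y) (transport y x) \<circ> partial_shift X (orbit x) (transport x y)
        = restriction X (orbit y)"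
      by (subst partial_shift_comp[OF orbit_subset[OF X(1)] t], rule partial_shift_cong)
        (use transport_inverse[OF y x] in auto)
    moreover have "partial_shift X (orbit x) (transport x y) \<circ> restriction X (orbit y)
        = partial_shift X (orbit x) (transport x y)"
      by (subst partial_shift_comp, use orbit_subset[OF X(2)] in auto,
          rule partial_shift_cong) (use transport_inverse[OF x y] in auto)
    ultimately show ?thesis by blast
  qed
  have "is_adjoint X (partial_shift X (orbit y) (transport y x)) (partial_shift X (orbit x) (transport x y))"
    by (rule partial_shift_adjoint)
      (use x y transport_bij transport_inverse(2) orbit_subset[OF subsetD[OF free_points_subset]] in blast)+
  then show ?thesis
    using that shift[OF x y] shift[OF y x] by blast
qed

subsection \<open>The homogeneous summand\<close>

text \<open>Only finitely many orbits meet the finite set that carries most of the norm of \<open>f\<close>.\<close>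

lemma orbit_exhaustion:
  assumes disj: "\<And>i j. i \<noteq> j \<Longrightarrow> orbit (g i) \<inter> orbit (g j) = {}"
    and g: "\<And>i. g i \<in> free_points" and cover: "free_points = (\<Union>i. orbit (g i))"
    and f: "f \<in> ell2 X"
  shows "((\<lambda>F. ell2_norm X (\<lambda>x. (\<Sum>i\<in>F. restriction X (orbit (g i)) f x)
      - restriction X free_points f x)) \<longlongrightarrow> 0) (finite_subsets_at_top (UNIV :: nat set))"
proof (rule tendstoI)
  fix \<epsilon> :: real assume "\<epsilon> > 0"
  obtain E where E: "finite E" "E \<subseteq> X" and
    tail: "\<And>Y. Y \<subseteq> X \<Longrightarrow> Y \<inter> E = {} \<Longrightarrow> ell2_norm X (\<lambda>x. if x \<in> Y then f x else 0) < \<epsilon>"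
    using ell2_small_tail[OF f \<open>\<epsilon> > 0\<close>] by blast
  have "\<forall>x\<in>E \<inter> free_points. \<exists>i. x \<in> orbit (g i)" using cover by blast
  then obtain idx where idx: "\<And>x. x \<in> E \<inter> free_points \<Longrightarrow> x \<in> orbit (g (idx x))" by metis
  have close: "dist (ell2_norm X (\<lambda>x. (\<Sum>i\<in>F. restriction X (orbit (g i)) f x)
      - restriction X free_points f x)) 0 < \<epsilon>"
    if F: "finite F" "idx ` (E \<inter> free_points) \<subseteq> F" for F
  proof -
    let ?Y = "free_points - (\<Union>i\<in>F. orbit (g i))"
    have "(\<Sum>i\<in>F. restriction X (orbit (g i)) f x) - restriction X free_points f x
        = - (if x \<in> ?Y then f x else 0)" for x
    proof (cases "\<exists>i\<in>F. x \<in> orbit (g i)")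
      case True
      then obtain i where i: "i \<in> F" "x \<in> orbit (g i)" by blast
      then have "x \<notin> orbit (g j)" if "j \<noteq> i" for j
        using disj[of j i] that by blast
      then have "(\<Sum>j\<in>F. restriction X (orbit (g j)) f x) = (\<Sum>j\<in>F. if j = i then f x else 0)"
        using i(2) by (intro sum.cong) (auto simp: partial_shift_apply[OF f])
      also have "\<dots> = f x" using F(1) i(1) by simp
      finally show ?thesis using i cover by (auto simp: partial_shift_apply[OF f])
    next
      case False
      then show ?thesis by (auto simp: partial_shift_apply[OF f])
    qed
    then have "ell2_norm X (\<lambda>x. (\<Sum>i\<in>F. restriction X (orbit (g i)) f x)
        - restriction X free_points f x) = ell2_norm X (\<lambda>x. if x \<in> ?Y then f x else 0)"
      by (simp add: ell2_norm_def)
    also have "\<dots> < \<epsilon>"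
      by (rule tail) (use free_points_subset idx F(2) in auto)
    finally show ?thesis by simp
  qed
  show "\<forall>\<^sub>F F in finite_subsets_at_top UNIV.
      dist (ell2_norm X (\<lambda>x. (\<Sum>i\<in>F. restriction X (orbit (g i)) f x)
        - restriction X free_points f x)) 0 < \<epsilon>"
    unfolding eventually_finite_subsets_at_top
    by (rule exI[of _ "idx ` (E \<inter> free_points)"]) (use E(1) close in simp)
qed

text \<open>The elements of \<open>W\<close> are free, and they lie in pairwise different double cosets. The latter
  follows from rigidity with \<open>g' = h g k\<close>, because \<open>h = k = 1\<close> gives \<open>g = g'\<close>.\<close>

theorem infinity_in_pukanszky_invariant:
  assumes countable: "countable X"
    and W: "infinite W" "W \<subseteq> X"
    and rigid: "\<And>g g' h k. g \<in> W \<Longrightarrow> g' \<in> W \<Longrightarrow> h \<in> H \<Longrightarrow> k \<in> H \<Longrightarrow>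
      h \<otimes> g \<otimes> k = g' \<Longrightarrow> h = \<one> \<and> k = \<one>"
  shows "\<infinity> \<in> pukanszky_invariant G H"
proof -
  define \<D> where "\<D> = orbit ` free_points"
  have W_free: "W \<subseteq> free_points"
    using W(2) rigid unfolding free_points_def act_def by blast
  have "inj_on orbit W"
  proof (rule inj_onI)
    fix g g' assume g: "g \<in> W" "g' \<in> W" "orbit g = orbit g'"
    then have "g' \<in> orbit g" using W(2) by auto
    then obtain h k where hk: "h \<in> H" "k \<in> H" "g' = act h k g" by (rule in_orbitE)
    then have "h = \<one> \<and> k = \<one>" using rigid g unfolding act_def by blast
    then show "g = g'" using hk g W(2) by auto
  qed
  then have "infinite (orbit ` W)" using W(1) finite_imageD by blast
  then have "infinite \<D>"
    unfolding \<D>_def by (rule infinite_super[OF image_mono[OF W_free]])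
  moreover have "countable \<D>"
    unfolding \<D>_def by (intro countable_image countable_subset[OF free_points_subset countable])
  ultimately have enum: "bij_betw (from_nat_into \<D>) UNIV \<D>" by (intro bij_betw_from_nat_into)
  have "\<forall>i. \<exists>x\<in>free_points. from_nat_into \<D> i = orbit x"
  proof
    fix i
    have "from_nat_into \<D> i \<in> \<D>" using enum by (auto simp: bij_betw_def)
    then show "\<exists>x\<in>free_points. from_nat_into \<D> i = orbit x" by (auto simp: \<D>_def)
  qed
  then obtain g where g: "\<And>i. g i \<in> free_points" "\<And>i. from_nat_into \<D> i = orbit (g i)" by metis
  have gX: "g i \<in> X" for i using g free_points_subset by blast
  have disj: "orbit (g i) \<inter> orbit (g j) = {}" if "i \<noteq> j" for i j
  proof (rule ccontr)
    assume "orbit (g i) \<inter> orbit (g j) \<noteq> {}"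
    then have "orbit (g i) = orbit (g j)" using orbit_eq[OF gX] by (metis IntE ex_in_conv)
    then have "from_nat_into \<D> i = from_nat_into \<D> j" using g(2) by simp
    then show False using enum that by (auto simp: bij_betw_def inj_on_def)
  qed
  have cover: "free_points = (\<Union>i. orbit (g i))"
  proof
    show "free_points \<subseteq> (\<Union>i. orbit (g i))"
    proof
      fix x assume x: "x \<in> free_points"
      then have "orbit x \<in> range (from_nat_into \<D>)"
        using enum unfolding bij_betw_def by (simp add: \<D>_def)
      then obtain i where "orbit x = orbit (g i)" using g(2) by auto
      then show "x \<in> (\<Union>i. orbit (g i))" using orbit_self[of x] x free_points_subset by auto
    qed
  qed (use orbit_free g in blast)

  define z where "z = restriction X free_points"
  define q where "q = complement_projection X (ell2_projection X H)"
  define M where "M = reduced_algebra (commutant X (left_right_algebra G H)) q"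
  define N where "N = reduced_algebra M z"
  have z_K: "z \<in> K" unfolding z_def by (rule restriction_free_in_K)
  have q: "q = restriction X (X - H)"
    unfolding q_def complement_projection_def ell2_projection_def partial_shift_def operator_on_def
    by (auto simp: fun_eq_iff ell2_outside)
  have qz: "q \<circ> z = z" and zq: "z \<circ> q = z"
    unfolding q z_def using free_points_disjoint free_points_subset
    by (auto simp: restriction_comp intro!: arg_cong[of _ _ "restriction X"])
  have M: "M = {A \<circ> q | A. A \<in> K}"
    by (simp add: M_def reduced_algebra_def commutant_left_right_algebra)
  have N_K: "A \<in> K" if "A \<in> N" for A
  proof -
    obtain B where "B \<in> K" "A = B \<circ> q \<circ> z"
      using \<open>A \<in> N\<close> by (auto simp: N_def reduced_algebra_def M)
    then show ?thesis using z_K qz by (simp add: o_assoc[symmetric] commutant_comp)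
  qed
  have N_I: "A \<in> N" if "A \<in> K" "A \<circ> z = A" for A
  proof -
    have "A = A \<circ> q \<circ> z" using that(2) qz by (simp add: o_assoc[symmetric])
    then show ?thesis unfolding N_def reduced_algebra_def M using that(1) by blast
  qed
  have central: "central_projection X M z"
    unfolding central_projection_def
  proof (intro conjI ballI)
    show "is_projection X z"
      unfolding z_def by (rule restriction_projection[OF free_points_subset])
    show "z \<in> M" unfolding M by (rule CollectI, rule exI[of _ z]) (use z_K zq in simp)
    fix A assume "A \<in> M"
    then obtain B where B: "B \<in> K" "A = B \<circ> q" by (auto simp: M)
    have "z \<circ> A = B \<circ> (z \<circ> q)"
      using restriction_free_central[OF B(1)] B(2) by (simp add: z_def o_assoc)
    also have "\<dots> = A \<circ> z" using B(2) qz zq by (simp add: o_assoc[symmetric])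
    finally show "z \<circ> A = A \<circ> z" .
  qed
  have "z \<noteq> (\<lambda>_ _. 0)"
  proof
    assume "z = (\<lambda>_ _. 0)"
    then have "z (point_mass (g 0)) (g 0) = 0" by simp
    then show False using g(1) gX by (simp add: z_def restriction_point_mass)
  qed
  moreover have "homogeneous_type_I X N z \<infinity>"
  proof -
    let ?e = "\<lambda>i. restriction X (orbit (g i))"
    have orbit_z: "?e i \<circ> z = ?e i" for i
      unfolding z_def using orbit_free[OF g(1)] free_points_subset
      by (auto simp: restriction_comp Int_absorb2)
    have e_K: "?e i \<in> K" for i by (rule restriction_orbit_in_K[OF gX])
    have "abelian_projection X N (?e i)" for i
      unfolding abelian_projection_def
      using restriction_projection[OF orbit_subset[OF gX]] N_I[OF e_K orbit_z] corner_commute[OF _ _ g(1)] N_K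
      by blast
    moreover have "equivalent_projections X N (?e i) (?e j)" for i j
    proof -
      obtain v w where vw: "v \<in> K" "w \<in> K" "is_adjoint X v w" "w \<circ> v = ?e i" "v \<circ> w = ?e j"
        "v \<circ> ?e i = v" "w \<circ> ?e j = w"
        using orbits_equivalent[OF g(1) g(1)] by blast
      have "v \<circ> z = v" "w \<circ> z = w"
        using vw(6,7) orbit_z by (metis o_assoc)+
      then show ?thesis
        unfolding equivalent_projections_def using vw N_I by blast
    qed
    moreover have "?e i \<circ> ?e j = (\<lambda>_ _. 0)" if "i \<noteq> j" for i j
      using disj[OF that] by (simp add: restriction_comp[OF orbit_subset[OF gX]] restriction_empty)
    moreover have "((\<lambda>F. ell2_norm X (\<lambda>x. (\<Sum>i\<in>F. ?e i f x) - z f x)) \<longlongrightarrow> 0)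
        (finite_subsets_at_top UNIV)" if "f \<in> ell2 X" for f
      unfolding z_def by (rule orbit_exhaustion[OF disj g(1) cover that])
    ultimately show ?thesis
      unfolding homogeneous_type_I_def Let_def by (intro exI[of _ ?e]) simp
  qed
  ultimately show ?thesis
    unfolding pukanszky_invariant_def has_type_I_summand_def
    using central by (auto simp: M_def N_def q_def)
qed

end

section \<open>Normal forms in the group of a triangle presentation\<close>

text \<open>This is Newman's lemma.\<close>

lemma locally_confluent_imp_confluent:
  assumes wf: "wf {(v, u). r u v}"
    and local: "\<And>u v w. r u v \<Longrightarrow> r u w \<Longrightarrow> \<exists>t. r\<^sup>*\<^sup>* v t \<and> r\<^sup>*\<^sup>* w t"
    and "r\<^sup>*\<^sup>* u v" "r\<^sup>*\<^sup>* u w"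
  shows "\<exists>t. r\<^sup>*\<^sup>* v t \<and> r\<^sup>*\<^sup>* w t"
  using wf assms(3,4)
proof (induction u arbitrary: v w rule: wf_induct_rule)
  case (less u)
  have first: "\<exists>b. r a b \<and> r\<^sup>*\<^sup>* b c" if "r\<^sup>*\<^sup>* a c" "a \<noteq> c" for a c
    using that by (induction rule: converse_rtranclp_induct) auto
  show ?case
  proof (cases "u = v \<or> u = w")
    case True
    then show ?thesis using less.prems by blast
  next
    case False
    obtain v' where v': "r u v'" "r\<^sup>*\<^sup>* v' v"
      using first[OF less.prems(1)] False by blast
    obtain w' where w': "r u w'" "r\<^sup>*\<^sup>* w' w"
      using first[OF less.prems(2)] False by blast
    obtain t where t: "r\<^sup>*\<^sup>* v' t" "r\<^sup>*\<^sup>* w' t"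
      using local[OF v'(1) w'(1)] by blast
    obtain t' where t': "r\<^sup>*\<^sup>* v t'" "r\<^sup>*\<^sup>* t t'"
      using less.IH[of v' v t] v' t by auto
    obtain t'' where "r\<^sup>*\<^sup>* t' t''" "r\<^sup>*\<^sup>* w t''"
      using less.IH[of w' t' w] w' rtranclp_trans[OF t(2) t'(2)] by auto
    then show ?thesis using t'(1) by (meson rtranclp_trans)
  qed
qed

context triangle_presentation
begin

lemma triple_points: "(x, y, z) \<in> T \<Longrightarrow> x \<in> P \<and> y \<in> P \<and> z \<in> P"
  using triples by auto

lemma triple_incident: "(x, y, z) \<in> T \<Longrightarrow> I y (lam x)"
  using extends_iff triple_points by blast

lemma lam_line: "x \<in> P \<Longrightarrow> lam x \<in> L"
  using bij_lam by (auto simp: bij_betw_def)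

lemma lam_inj: "x \<in> P \<Longrightarrow> y \<in> P \<Longrightarrow> lam x = lam y \<Longrightarrow> x = y"
  using bij_lam by (auto simp: bij_betw_def inj_on_def)

lemma lam_join_unique:
  assumes "x \<noteq> y" "x \<in> P" "y \<in> P" "w \<in> P" "w' \<in> P"
    "I x (lam w)" "I y (lam w)" "I x (lam w')" "I y (lam w')"
  shows "w = w'"
  using assms unique_line lam_line lam_inj by metis

text \<open>Each rule records a relation between at most four generators. The last one comes from
  \<open>a\<^sub>x a\<^sub>s = a\<^sub>w\<^sup>-\<^sup>1 = a\<^sub>y a\<^sub>t\<close>, where \<open>\<lambda>(w)\<close> is the line joining \<open>x\<close> and \<open>y\<close>.\<close>

inductive rewrite :: "'p \<times> bool \<Rightarrow> 'p \<times> bool \<Rightarrow> ('p \<times> bool) list \<Rightarrow> bool" where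
  pos_pos: "(x, y, z) \<in> T \<Longrightarrow> rewrite (x, True) (y, True) [(z, False)]"
| neg_neg: "(y, x, z) \<in> T \<Longrightarrow> rewrite (x, False) (y, False) [(z, True)]"
| inverse: "rewrite (x, s) (x, \<not> s) []"
| neg_pos: "x \<noteq> y \<Longrightarrow> (w, x, s) \<in> T \<Longrightarrow> (w, y, t) \<in> T \<Longrightarrow>
    rewrite (x, False) (y, True) [(s, True), (t, False)]"

inductive step :: "('p \<times> bool) list \<Rightarrow> ('p \<times> bool) list \<Rightarrow> bool" where
  "rewrite l m r \<Longrightarrow> step (p @ [l, m] @ s) (p @ r @ s)"

lemma step_context: "step u v \<Longrightarrow> step (p @ u @ s) (p @ v @ s)"
proof (induction rule: step.induct)
  case (1 l m r p' s')
  show ?case using step.intros[OF 1, of "p @ p'" "s' @ s"] by simp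
qed

lemma steps_context: "step\<^sup>*\<^sup>* u v \<Longrightarrow> step\<^sup>*\<^sup>* (p @ u @ s) (p @ v @ s)"
  by (induction rule: rtranclp_induct) (auto intro: step_context rtranclp.rtrancl_into_rtrancl)

lemma step_pair: "rewrite l m r \<Longrightarrow> step [l, m] r"
  using step.intros[of l m r "[]" "[]"] by simp

lemma step_pair_left: "rewrite l m r \<Longrightarrow> step (l # m # s) (r @ s)"
  using step.intros[of l m r "[]" s] by simp

lemma step_pair_right: "rewrite l m r \<Longrightarrow> step (k # l # m # s) (k # r @ s)"
  using step.intros[of l m r "[k]" s] by simp

lemma inverse_pos: "rewrite (x, True) (x, False) []"
  and inverse_neg: "rewrite (x, False) (x, True) []"
  using inverse[of x True] inverse[of x False] by auto

text \<open>The critical pairs. In each of them both results rewrite to the same word because the points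
  and lines that occur lie in a common configuration: whenever two points have to be joined, they are
  seen to lie on a line \<open>\<lambda>(w)\<close> for a point \<open>w\<close> that already occurs in the word.\<close>

lemma overlaps_joinable:
  assumes "rewrite l m r" "rewrite m n r'"
  shows "\<exists>v. step\<^sup>*\<^sup>* (r @ [n]) v \<and> step\<^sup>*\<^sup>* (l # r') v"
proof -
  have join: ?thesis if "step\<^sup>*\<^sup>* (r @ [n]) v" "step\<^sup>*\<^sup>* (l # r') v" for v
    using that by blast
  have one: "step u v \<Longrightarrow> step\<^sup>*\<^sup>* u v" for u v by blast
  have two: "step u v \<Longrightarrow> step v w \<Longrightarrow> step\<^sup>*\<^sup>* u w" for u v w by (meson one rtranclp.rtrancl_into_rtrancl)
  show ?thesis
    using assms(1)
  proof cases
    case 1: (pos_pos x y z)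
    from assms(2) show ?thesis
      unfolding 1(2)
    proof cases
      case 2: (pos_pos x' z')
      show ?thesis
      proof (cases "z = x'")
        case True
        then have "z' = x" using 1 2 cyclic unique_third by blast
        then show ?thesis
          using True 1 2 inverse_pos[of x] inverse_neg[of z] by (intro join[of "[]"]) (auto intro!: one step_pair)
      next
        case False
        have "rewrite (z, False) (x', True) [(x, True), (z', False)]"
          using False by (rule neg_pos) (use 1 2 cyclic in blast)+
        then show ?thesis
          using 1 2 by (intro join[of "[(x, True), (z', False)]"]) (auto intro!: one step_pair)
      qed
    next
      case 2: inverse
      have "rewrite (z, False) (y, False) [(x, True)]"
        using 1 cyclic by (intro neg_neg) blast
      then show ?thesis
        using 1 2 by (intro join[of "[(x, True)]"]) (auto intro!: one step_pair)
    qed auto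
  next
    case 1: (neg_neg y x z)
    from assms(2) show ?thesis
      unfolding 1(2)
    proof cases
      case 2: (neg_neg u z')
      show ?thesis
      proof (cases "x = z'")
        case True
        then have "z = u" using 1 2 cyclic unique_third by blast
        then show ?thesis
          using True 1 2 inverse_pos[of z] inverse_neg[of x] by (intro join[of "[]"]) (auto intro!: one step_pair)
      next
        case False
        have "rewrite (x, False) (z', True) [(z, True), (u, False)]"
          using False by (rule neg_pos) (use 1 2 cyclic in blast)+
        then show ?thesis
          using 1 2 by (intro join[of "[(z, True), (u, False)]"]) (auto intro!: one step_pair)
      qed
    next
      case 2: inverse
      have "rewrite (z, True) (y, True) [(x, False)]"
        using 1 cyclic by (intro pos_pos) blast
      then show ?thesis
        using 1 2 by (intro join[of "[(x, False)]"]) (auto intro!: one step_pair)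
    next
      case 2: (neg_pos u w s t)
      show ?thesis
      proof (cases "x = s")
        case True
        then have "w = z" using 1 2 cyclic unique_third by blast
        have "rewrite (z, True) (u, True) [(t, False)]"
          using 2 \<open>w = z\<close> by (intro pos_pos) blast
        moreover have "rewrite (x, False) (s, True) []"
          using True inverse_neg by blast
        ultimately show ?thesis
          using 1 2 by (intro join[of "[(t, False)]"]) (auto intro!: one step_pair dest: step_pair_left)
      next
        case False
        have r1: "rewrite (x, False) (s, True) [(z, True), (w, False)]"
          using False by (rule neg_pos) (use 1 2 cyclic in blast)+
        have r2: "rewrite (w, False) (t, False) [(u, True)]"
          using 2 cyclic by (intro neg_neg) blast
        have "step\<^sup>*\<^sup>* [(x, False), (s, True), (t, False)] [(z, True), (u, True)]"
          using two[OF step_pair_left[OF r1, of "[(t, False)]", simplified]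
            step_pair_right[OF r2, of "(z, True)" "[]", simplified]] .
        then show ?thesis
          using 1 2 by (intro join[of "[(z, True), (u, True)]"]) auto
      qed
    qed auto
  next
    case 1: (inverse x b)
    from assms(2) show ?thesis
      unfolding 1(2)
    proof cases
      case 2: (pos_pos y z)
      have "rewrite (x, False) (z, False) [(y, True)]"
        using 2 cyclic by (intro neg_neg) blast
      then show ?thesis
        using 1 2 by (intro join[of "[(y, True)]"]) (auto intro!: one step_pair)
    next
      case 2: (neg_neg y z)
      have "rewrite (x, True) (z, True) [(y, False)]"
        using 2 cyclic by (intro pos_pos) blast
      then show ?thesis
        using 1 2 by (intro join[of "[(y, False)]"]) (auto intro!: one step_pair)
    next
      case 2: inverse
      then show ?thesis
        using 1 by (intro join[of "[(x, b)]"]) auto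
    next
      case 2: (neg_pos y w s t)
      have r1: "rewrite (x, True) (s, True) [(w, False)]"
        using 2 cyclic by (intro pos_pos) blast
      have r2: "rewrite (w, False) (t, False) [(y, True)]"
        using 2 cyclic by (intro neg_neg) blast
      have "step\<^sup>*\<^sup>* [(x, True), (s, True), (t, False)] [(y, True)]"
        using two[OF step_pair_left[OF r1, of "[(t, False)]", simplified] step_pair[OF r2]] .
      then show ?thesis
        using 1 2 by (intro join[of "[(y, True)]"]) auto
    qed
  next
    case 1: (neg_pos x y w s t)
    from assms(2) show ?thesis
      unfolding 1(2)
    proof cases
      case 2: (pos_pos u v)
      have sw: "rewrite (s, True) (w, True) [(x, False)]"
        using 1 cyclic by (intro pos_pos) blast
      show ?thesis
      proof (cases "t = u")
        case True
        then have "v = w" using 1 2 cyclic unique_third by blast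
        have "rewrite (x, False) (v, False) [(s, True)]"
          using 1 \<open>v = w\<close> by (intro neg_neg) blast
        moreover have "step [(s, True), (t, False), (u, True)] [(s, True)]"
          using step_pair_right[OF inverse_neg[of t], of "(s, True)" "[]"] True by simp
        ultimately show ?thesis
          using 1 2 by (intro join[of "[(s, True)]"]) (auto intro!: one step_pair)
      next
        case False
        have r1: "rewrite (t, False) (u, True) [(w, True), (v, False)]"
          using False by (rule neg_pos) (use 1 2 cyclic in blast)+
        then have "step\<^sup>*\<^sup>* [(s, True), (t, False), (u, True)] [(x, False), (v, False)]"
          using two[OF step_pair_right[OF r1, of "(s, True)" "[]", simplified]
            step_pair_left[OF sw, of "[(v, False)]", simplified]] by simp
        then show ?thesis
          using 1 2 by (intro join[of "[(x, False), (v, False)]"]) auto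
      qed
    next
      case 2: inverse
      have r1: "rewrite (t, False) (y, False) [(w, True)]"
        using 1 cyclic by (intro neg_neg) blast
      have r2: "rewrite (s, True) (w, True) [(x, False)]"
        using 1 cyclic by (intro pos_pos) blast
      have "step\<^sup>*\<^sup>* [(s, True), (t, False), (y, False)] [(x, False)]"
        using two[OF step_pair_right[OF r1, of "(s, True)" "[]", simplified] step_pair[OF r2]] .
      then show ?thesis
        using 1 2 by (intro join[of "[(x, False)]"]) auto
    qed auto
  qed
qed

text \<open>The only rule with a choice is the last one, and \<open>w\<close> is determined there because only one line joins
  \<open>x\<close> and \<open>y\<close>.\<close>

lemma rewrite_deterministic: "rewrite l m r \<Longrightarrow> rewrite l m r' \<Longrightarrow> r = r'"
proof (induction rule: rewrite.induct)
  case (neg_pos x y w s t)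
  from neg_pos(4) show ?case
  proof cases
    case 1: (neg_pos w' s' t')
    have "w = w'"
      using lam_join_unique[of x y w w'] 1 neg_pos triple_points triple_incident by blast
    then show ?thesis using 1 neg_pos unique_third by blast
  qed (use neg_pos in auto)
qed (auto elim: rewrite.cases dest: unique_third)

text \<open>All left sides have two letters. Two occurrences of left sides in a word therefore coincide, overlap
  in a single letter, or are disjoint and can be rewritten independently.\<close>

lemma step_locally_confluent:
  assumes "step u v" "step u w"
  shows "\<exists>t. step\<^sup>*\<^sup>* v t \<and> step\<^sup>*\<^sup>* w t"
proof -
  have *: "\<exists>t. step\<^sup>*\<^sup>* (p @ r @ s) t \<and> step\<^sup>*\<^sup>* (p' @ r' @ s') t"
    if eq: "p @ [l, m] @ s = p' @ [l', m'] @ s'" and le: "length p \<le> length p'"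
      and r: "rewrite l m r" "rewrite l' m' r'" for p l m s r p' l' m' s' r'
  proof -
    obtain d where d: "p' = p @ d" "[l, m] @ s = d @ [l', m'] @ s'"
    proof -
      obtain us where "(p = p' @ us \<and> us @ [l, m] @ s = [l', m'] @ s') \<or>
          (p @ us = p' \<and> [l, m] @ s = us @ [l', m'] @ s')"
        using eq unfolding append_eq_append_conv2 by blast
      then show ?thesis using that[of us] that[of "[]"] le by auto
    qed
    consider "d = []" | "d = [l]" | d' where "d = l # m # d'"
    proof (cases d)
      case (Cons k ks)
      then show ?thesis using d that by (cases ks) auto
    qed (use that in blast)
    then show ?thesis
    proof cases
      case 1
      then have "r = r'" "s = s'"
        using d r rewrite_deterministic by auto
      then show ?thesis using 1 d by auto
    next
      case 2
      then have "m = l'" "s = m' # s'" using d by auto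
      then obtain t where "step\<^sup>*\<^sup>* (r @ [m']) t" "step\<^sup>*\<^sup>* (l # r') t"
        using overlaps_joinable r by blast
      then have "step\<^sup>*\<^sup>* (p @ (r @ [m']) @ s') (p @ t @ s')" "step\<^sup>*\<^sup>* (p @ (l # r') @ s') (p @ t @ s')"
        by (blast intro: steps_context)+
      then show ?thesis
        using 2 d(1) \<open>s = m' # s'\<close> by auto
    next
      case 3
      then have s: "s = d' @ [l', m'] @ s'" using d by auto
      have "step (p @ r @ s) (p @ r @ d' @ r' @ s')"
        using step.intros[OF r(2), of "p @ r @ d'" s'] s by simp
      moreover have "step (p' @ r' @ s') (p @ r @ d' @ r' @ s')"
        using step.intros[OF r(1), of p "d' @ r' @ s'"] d 3 by simp
      ultimately show ?thesis by blast
    qed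
  qed
  from assms(1) obtain p l m r s where u: "u = p @ [l, m] @ s" "v = p @ r @ s" "rewrite l m r"
    by cases
  from assms(2) obtain p' l' m' r' s' where
    w: "u = p' @ [l', m'] @ s'" "w = p' @ r' @ s'" "rewrite l' m' r'"
    by cases
  show ?thesis
  proof (cases "length p \<le> length p'")
    case True
    then show ?thesis using *[OF _ True u(3) w(3)] u w by simp
  next
    case False
    then have "\<exists>t. step\<^sup>*\<^sup>* w t \<and> step\<^sup>*\<^sup>* v t" using *[OF _ _ w(3) u(3)] u w by simp
    then show ?thesis by blast
  qed
qed

text \<open>Among words of equal length, this weight decreases when a letter with exponent \<open>-1\<close> moves to
  the right past one with exponent \<open>1\<close>.\<close>

fun sign_weight :: "('p \<times> bool) list \<Rightarrow> nat" where
  "sign_weight [] = 0"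
| "sign_weight ((x, s) # w) = (if s then sign_weight w + 1 else 2 * sign_weight w + 1)"

lemma sign_weight_append_mono:
  "sign_weight u < sign_weight v \<Longrightarrow> sign_weight (p @ u) < sign_weight (p @ v)"
  by (induction p rule: sign_weight.induct) auto

lemma step_decreases:
  "step u v \<Longrightarrow> length v < length u \<or> length v = length u \<and> sign_weight v < sign_weight u"
proof (induction rule: step.induct)
  case (1 l m r p s)
  from 1 show ?case
    by cases (auto intro!: sign_weight_append_mono)
qed

lemma wf_step: "wf {(v, u). step u v}"
proof (rule wf_subset)
  show "wf (measures [length, sign_weight])" by simp
qed (use step_decreases in auto)

lemma steps_length: "step\<^sup>*\<^sup>* u v \<Longrightarrow> length v \<le> length u"
proof (induction rule: rtranclp_induct)
  case (step v w)
  then show ?case using step_decreases[of v w] by linarith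
qed simp

text \<open>Confluence is needed for transitivity. A relator \<open>a\<^sub>x a\<^sub>y a\<^sub>z\<close> rewrites to \<open>a\<^sub>z\<^sup>-\<^sup>1 a\<^sub>z\<close> and then to
  the empty word.\<close>

lemma word_rel_joinable:
  assumes "(u, v) \<in> word_rel P (triangle_relators T)"
  shows "\<exists>w. step\<^sup>*\<^sup>* u w \<and> step\<^sup>*\<^sup>* v w"
  using assms
proof (induction rule: word_rel.induct)
  case (trans u v w)
  then obtain s t where st: "step\<^sup>*\<^sup>* u s" "step\<^sup>*\<^sup>* v s" "step\<^sup>*\<^sup>* v t" "step\<^sup>*\<^sup>* w t" by blast
  then obtain t' where "step\<^sup>*\<^sup>* s t'" "step\<^sup>*\<^sup>* t t'"
    using locally_confluent_imp_confluent[of step, OF wf_step _ st(2,3)] step_locally_confluent by blast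
  then show ?case using st by (meson rtranclp_trans)
next
  case (cancel u v x s)
  then show ?case using step.intros[OF inverse[of x s], of u v] by auto
next
  case (relator u v r)
  then obtain x y z where r: "r = [(x, True), (y, True), (z, True)]" "(x, y, z) \<in> T"
    by (auto simp: triangle_relators_def)
  have "step (u @ r @ v) (u @ [(z, False), (z, True)] @ v)"
    using step.intros[OF pos_pos[OF r(2)], of u "(z, True) # v"] r(1) by simp
  moreover have "step (u @ [(z, False), (z, True)] @ v) (u @ v)"
    using step.intros[OF inverse_neg[of z], of u v] by simp
  ultimately have "step\<^sup>*\<^sup>* (u @ r @ v) (u @ v)"
    by (rule converse_rtranclp_into_rtranclp[OF _ r_into_rtranclp])
  then show ?case by blast
qed auto

definition reduced :: "('p \<times> bool) list \<Rightarrow> bool" where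
  "reduced = successively (\<lambda>l m. \<nexists>r. rewrite l m r)"

lemma reduced_steps: "reduced u \<Longrightarrow> step\<^sup>*\<^sup>* u v \<Longrightarrow> v = u"
proof (erule converse_rtranclpE)
  fix w assume u: "reduced u" "step u w"
  from u(2) show "v = u"
    by cases (use u(1) in \<open>auto simp: reduced_def successively_append_iff\<close>)
qed auto

text \<open>No rule lengthens a word, and every word equivalent to a reduced one rewrites to it.\<close>

lemma reduced_shortest:
  "(u, v) \<in> word_rel P (triangle_relators T) \<Longrightarrow> reduced u \<Longrightarrow> length u \<le> length v"
  using word_rel_joinable reduced_steps steps_length by blast

lemma reduced_unique:
  "(u, v) \<in> word_rel P (triangle_relators T) \<Longrightarrow> reduced u \<Longrightarrow> reduced v \<Longrightarrow> u = v"
  using word_rel_joinable reduced_steps by blast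

lemma reduced_positive_negative:
  assumes "successively (\<lambda>x y. \<not> I y (lam x)) xs" "\<not> I y (lam y)" "xs \<noteq> [] \<Longrightarrow> last xs \<noteq> y"
  shows "reduced (map (\<lambda>x. (x, True)) xs @ replicate n (y, False))"
proof -
  have pos: "\<nexists>r. rewrite (x, True) (x', True) r" if "\<not> I x' (lam x)" for x x'
    using that by (auto elim: rewrite.cases dest: triple_incident)
  have neg: "\<nexists>r. rewrite (y, False) (y, False) r"
    using assms(2) by (auto elim: rewrite.cases dest: triple_incident)
  have mid: "\<nexists>r. rewrite (x, True) (y, False) r" if "x \<noteq> y" for x
    using that by (auto elim: rewrite.cases)
  have "reduced (map (\<lambda>x. (x, True)) xs)"
    unfolding reduced_def successively_map
    by (rule successively_mono[OF assms(1)]) (use pos in auto)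
  moreover have "reduced (replicate n (y, False))"
    unfolding reduced_def
  proof (induction n)
    case (Suc n)
    then show ?case using neg by (cases n) auto
  qed simp
  ultimately show ?thesis
    unfolding reduced_def successively_append_iff using assms(3) mid
    by (auto simp: last_map)
qed

section \<open>Words as elements of the group\<close>

abbreviation \<Gamma> :: "('p \<times> bool) list set monoid" where "\<Gamma> \<equiv> A2_group P T"

abbreviation gen :: "'p \<Rightarrow> ('p \<times> bool) list set" where "gen \<equiv> A2_generator P T"

definition element :: "('p \<times> bool) list \<Rightarrow> ('p \<times> bool) list set" where
  "element w = word_rel P (triangle_relators T) `` {w}"

lemma group_\<Gamma>: "group \<Gamma>"
  by (simp add: A2_group_def group_presented_group)

lemma countable_\<Gamma>: "countable (carrier \<Gamma>)"
proof -
  have "countable (words P)"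
    unfolding words_def using finite_points by (intro countable_lists countable_finite) auto
  then
show ?thesis unfolding A2_group_def presented_group_def quotient_def by auto
qed

lemma element_closed: "w \<in> words P \<Longrightarrow> element w \<in> carrier \<Gamma>"
  by (auto simp: element_def A2_group_def presented_group_def intro: quotientI)

lemma element_mult:
  "u \<in> words P \<Longrightarrow> v \<in> words P \<Longrightarrow> element u \<otimes>\<^bsub>\<Gamma>\<^esub> element v = element (u @ v)"
  by (simp add: element_def A2_group_def mult_presented_group_class)

lemma element_Nil: "element [] = \<one>\<^bsub>\<Gamma>\<^esub>"
  by (simp add: element_def A2_group_def presented_group_def)

lemma element_eq_iff:
  "u \<in> words P \<Longrightarrow> v \<in> words P \<Longrightarrow>
    element u = element v \<longleftrightarrow> (u, v) \<in> word_rel P (triangle_relators T)"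
  unfolding element_def using eq_equiv_class_iff[OF equiv_word_rel] by blast

lemma gen_eq_element: "gen x = element [(x, True)]"
  by (simp add: A2_generator_def generator_def element_def)

lemma gen_closed: "x \<in> P \<Longrightarrow> gen x \<in> carrier \<Gamma>"
  by (simp add: gen_eq_element element_closed)

lemma inv_gen_eq_element:
  assumes "x \<in> P" shows "inv\<^bsub>\<Gamma>\<^esub> gen x = element [(x, False)]"
proof -
  interpret group \<Gamma> by (rule group_\<Gamma>)
  have "([] @ [(x, False), (x, \<not> False)] @ [], [] @ []) \<in> word_rel P (triangle_relators T)"
    using assms by (intro word_rel.cancel) auto
  then have "element [(x, False)] \<otimes>\<^bsub>\<Gamma>\<^esub> gen x = \<one>\<^bsub>\<Gamma>\<^esub>"
    using assms by (simp add: gen_eq_element element_mult element_eq_iff flip: element_Nil)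
  then show ?thesis
    using assms by (intro inv_equality) (auto intro: element_closed gen_closed)
qed

lemma triple_product:
  assumes "(x, y, z) \<in> T" shows "gen x \<otimes>\<^bsub>\<Gamma>\<^esub> gen y \<otimes>\<^bsub>\<Gamma>\<^esub> gen z = \<one>\<^bsub>\<Gamma>\<^esub>"
proof -
  let ?r = "[(x, True), (y, True), (z, True)]"
  have "([] @ ?r @ [], [] @ []) \<in> word_rel P (triangle_relators T)"
    using assms triple_points[OF assms] by (intro word_rel.relator) (auto simp: triangle_relators_def)
  then show ?thesis
    using triple_points[OF assms] by (simp add: gen_eq_element element_mult element_eq_iff flip: element_Nil)
qed

lemma replicate_words: "x \<in> P \<Longrightarrow> replicate n (x, s) \<in> words P"
  by (auto simp: words_def)

lemma gen_pow: "x \<in> P \<Longrightarrow> gen x [^]\<^bsub>\<Gamma>\<^esub> n = element (replicate n (x, True))" for n :: nat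
proof (induction n)
  case 0
  interpret group \<Gamma> by (rule group_\<Gamma>)
  show ?case by (simp add: element_Nil)
next
  case (Suc n)
  interpret group \<Gamma> by (rule group_\<Gamma>)
  show ?case
    using Suc by (simp add: gen_eq_element element_mult replicate_words flip: replicate_append_same)
qed

lemma inv_gen_pow:
  "x \<in> P \<Longrightarrow> inv\<^bsub>\<Gamma>\<^esub> gen x [^]\<^bsub>\<Gamma>\<^esub> n = element (replicate n (x, False))" for n :: nat
proof (induction n)
  case 0
  interpret group \<Gamma> by (rule group_\<Gamma>)
  show ?case by (simp add: element_Nil)
next
  case (Suc n)
  interpret group \<Gamma> by (rule group_\<Gamma>)
  show ?case
    using Suc by (simp add: inv_gen_eq_element element_mult replicate_words flip: replicate_append_same)
qed

end

section \<open>Counting points and lines\<close>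

context finite_projective_plane
begin

text \<open>Projection from \<open>y\<close> matches the lines through \<open>y\<close> with the points of \<open>l\<^sub>0\<close>.\<close>

lemma card_lines_through:
  assumes y: "y \<in> P" and l0: "l0 \<in> L" "\<not> I y l0"
  shows "card {l \<in> L. I y l} = q + 1"
proof -
  have "\<forall>l\<in>{l \<in> L. I y l}. \<exists>x\<in>{x \<in> P. I x l0}. I x l"
    using unique_point l0 by blast
  then obtain meet where meet: "\<And>l. l \<in> {l \<in> L. I y l} \<Longrightarrow> meet l \<in> {x \<in> P. I x l0} \<and> I (meet l) l"
    by metis
  have "inj_on meet {l \<in> L. I y l}"
  proof (rule inj_onI)
    fix l l' assume l: "l \<in> {l \<in> L. I y l}" "l' \<in> {l \<in> L. I y l}" "meet l = meet l'"
    have "meet l \<in> P" "meet l \<noteq> y" "I (meet l) l" "I (meet l) l'"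
      using meet[OF l(1)] meet[OF l(2)] l(3) l0 by auto
    then show "l = l'" using unique_line[of "meet l" y] l y by blast
  qed
  then have le: "card {l \<in> L. I y l} \<le> card {x \<in> P. I x l0}"
    by (rule card_inj_on_le) (use meet finite_points in auto)
  have "\<forall>x\<in>{x \<in> P. I x l0}. \<exists>l\<in>{l \<in> L. I y l}. I x l"
  proof
    fix x assume "x \<in> {x \<in> P. I x l0}"
    then have "x \<in> P" "x \<noteq> y" using l0 by auto
    then show "\<exists>l\<in>{l \<in> L. I y l}. I x l" using unique_line[of x y] y by blast
  qed
  then obtain join where join: "\<And>x. x \<in> {x \<in> P. I x l0} \<Longrightarrow> join x \<in> {l \<in> L. I y l} \<and> I x (join x)"
    by metis
  have "inj_on join {x \<in> P. I x l0}"
  proof (rule inj_onI)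
    fix x x' assume x: "x \<in> {x \<in> P. I x l0}" "x' \<in> {x \<in> P. I x l0}" "join x = join x'"
    have "join x \<in> L" "join x \<noteq> l0" "I x (join x)" "I x' (join x)"
      using join[OF x(1)] join[OF x(2)] x(3) l0 by auto
    then show "x = x'" using unique_point[of "join x" l0] l0 x by blast
  qed
  then have "card {x \<in> P. I x l0} \<le> card {l \<in> L. I y l}"
    by (rule card_inj_on_le) (use join finite_lines in auto)
  then show ?thesis using le order[OF l0(1)] by simp
qed

text \<open>Among three points of the quadrangle other than \<open>y\<close>, not all lie on one line, so \<open>y\<close> cannot be on two of
  the lines joining them.\<close>

lemma line_avoiding_point:
  assumes y: "y \<in> P" obtains l where "l \<in> L" "\<not> I y l"
proof -
  obtain Q where Q: "Q \<subseteq> P" "card Q = 4" "\<And>l. l \<in> L \<Longrightarrow> card {x \<in> Q. I x l} \<le> 2"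
    using quadrangle by blast
  have "finite Q" using Q(2) by (metis card.infinite zero_neq_numeral)
  have "3 \<le> card (Q - {y})"
    using Q(2) \<open>finite Q\<close> by (simp add: card_Diff_singleton_if)
  then obtain R where R: "R \<subseteq> Q - {y}" "card R = 3" by (meson obtain_subset_with_card_n)
  then obtain u v w where uvw: "R = {u, v, w}" "u \<noteq> v" "v \<noteq> w" "u \<noteq> w"
    unfolding card_3_iff by blast
  have in_P: "u \<in> P" "v \<in> P" "w \<in> P" and neq: "u \<noteq> y"
    using R(1) Q(1) uvw(1) by auto
  obtain l where l: "l \<in> L" "I u l" "I v l" using unique_line[OF in_P(1,2) uvw(2)] by blast
  obtain m where m: "m \<in> L" "I u m" "I w m" using unique_line[OF in_P(1,3) uvw(4)] by blast
  show ?thesis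
  proof (cases "I y l \<and> I y m")
    case True
    then have "l = m" using unique_line[OF in_P(1) y neq] l m by blast
    then have "R \<subseteq> {x \<in> Q. I x l}" using R(1) uvw(1) l m by auto
    then have "card R \<le> card {x \<in> Q. I x l}"
      using \<open>finite Q\<close> by (intro card_mono) auto
    then show ?thesis using R(2) Q(3)[OF l(1)] by simp
  next
    case False
    then show ?thesis using that l m by blast
  qed
qed

lemma card_points: "card P = q\<^sup>2 + q + 1"
proof -
  obtain y where y: "y \<in> P"
    using quadrangle by (metis card.empty ex_in_conv subset_empty zero_neq_numeral)
  obtain l0 where l0: "l0 \<in> L" "\<not> I y l0" using line_avoiding_point[OF y] .
  let ?N = "{l \<in> L. I y l}" and ?S = "\<lambda>l. {x \<in> P. I x l} - {y}"
  have "card (\<Union>l\<in>?N. ?S l) = (\<Sum>l\<in>?N. card (?S l))"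
  proof (rule card_UN_disjoint)
    show "\<forall>l\<in>?N. \<forall>m\<in>?N. l \<noteq> m \<longrightarrow> ?S l \<inter> ?S m = {}"
      using unique_line[OF _ y] by blast
  qed (use finite_lines finite_points in auto)
  also have "\<dots> = (\<Sum>l\<in>?N. q)"
    using order y by (intro sum.cong) (auto simp: card_Diff_singleton_if finite_points)
  also have "\<dots> = (q + 1) * q"
    using card_lines_through[OF y l0] by simp
  finally have "card (\<Union>l\<in>?N. ?S l) = (q + 1) * q" .
  moreover have "P = insert y (\<Union>l\<in>?N. ?S l)"
    using unique_line[OF _ y] y by blast
  moreover have "card (insert y (\<Union>l\<in>?N. ?S l)) = Suc (card (\<Union>l\<in>?N. ?S l))"
    by (rule card_insert_disjoint) (use finite_lines finite_points in auto)
  ultimately have "card P = Suc ((q + 1) * q)"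
    by (simp only:)
  then show ?thesis by (simp add: power2_eq_square)
qed

end

context triangle_presentation
begin

lemma card_points_on: "x \<in> P \<Longrightarrow> card {y \<in> P. I y (lam x)} = q + 1"
  using order lam_line by blast

lemma card_points_dual:
  assumes "y \<in> P" shows "card {x \<in> P. I y (lam x)} = q + 1"
proof -
  obtain l0 where "l0 \<in> L" "\<not> I y l0" using line_avoiding_point[OF assms] .
  moreover have "bij_betw lam {x \<in> P. I y (lam x)} {l \<in> L. I y l}"
    using bij_lam by (auto simp: bij_betw_def inj_on_def)
  ultimately show ?thesis using card_lines_through[OF assms] bij_betw_same_card by metis
qed

text \<open>Each condition excludes \<open>q + 1\<close> points, and \<open>2 (q + 1) < q\<^sup>2 + q + 1\<close> for \<open>q \<ge> 2\<close>. The lemma provides a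
  letter that can be put between \<open>x\<close> and \<open>y\<close> without creating a left side of a rule.\<close>

lemma point_outside_two:
  assumes "q \<ge> 2" "x \<in> P" "y \<in> P"
  obtains z where "z \<in> P" "\<not> I z (lam x)" "\<not> I y (lam z)"
proof -
  let ?A = "{z \<in> P. I z (lam x)}" and ?B = "{z \<in> P. I y (lam z)}"
  have "card (?A \<union> ?B) \<le> (q + 1) + (q + 1)"
    using card_Un_le[of ?A ?B] card_points_on card_points_dual assms by simp
  also have "\<dots> < card P"
    using mult_le_mono1[OF \<open>q \<ge> 2\<close>, of q] \<open>q \<ge> 2\<close>
    unfolding card_points power2_eq_square by linarith
  finally have "\<not> P \<subseteq> ?A \<union> ?B"
    using card_mono[of "?A \<union> ?B" P] finite_points by auto
  then show ?thesis using that by blast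
qed

text \<open>Each of the three points lies in two of the sets, so that their union has at most
  \<open>3 (q + 1) - 3 = q\<^sup>2 + q + 1 - (q - 1)\<^sup>2\<close> elements.\<close>

lemma point_outside_triangle:
  assumes "q \<ge> 2" and card: "card A = q + 1" "card B = q + 1" "card C = q + 1"
    and "a \<noteq> b" "a \<noteq> c" "b \<noteq> c" "a \<in> B" "a \<in> C" "b \<in> A" "b \<in> C" "c \<in> A" "c \<in> B"
  obtains x where "x \<in> P" "x \<notin> A" "x \<notin> B" "x \<notin> C"
proof -
  have fin: "finite A" "finite B" "finite C"
    using card by (metis Suc_eq_plus1 card.infinite nat.distinct(1))+
  have union: "A \<union> B \<union> C = (A - {c}) \<union> (B - {a}) \<union> (C - {b})"
    using assms by blast
  have "card (A \<union> B \<union> C) \<le> card (A - {c}) + card (B - {a}) + card (C - {b})"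
    unfolding union using card_Un_le[of "(A - {c}) \<union> (B - {a})" "C - {b}"] card_Un_le[of "A - {c}" "B - {a}"]
    by linarith
  also have "\<dots> = 3 * q"
    using assms fin by (simp add: card_Diff_singleton_if)
  also have "\<dots> < card P"
    using mult_le_mono1[OF \<open>q \<ge> 2\<close>, of q] unfolding card_points power2_eq_square by linarith
  finally have "\<not> P \<subseteq> A \<union> B \<union> C"
    using card_mono[of "A \<union> B \<union> C" P] fin by auto
  then show ?thesis using that by blast
qed

section \<open>Commuting generators\<close>

lemma gen_mult_gen:
  assumes "(x, y, z) \<in> T" shows "gen x \<otimes>\<^bsub>\<Gamma>\<^esub> gen y = element [(z, False)]"
proof -
  interpret group \<Gamma> by (rule group_\<Gamma>)
  have "inv\<^bsub>\<Gamma>\<^esub> gen z = gen x \<otimes>\<^bsub>\<Gamma>\<^esub> gen y"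
    using triple_product[OF assms] triple_points[OF assms] by (intro inv_equality) (auto simp: gen_closed)
  then show ?thesis using inv_gen_eq_element triple_points[OF assms] by simp
qed

text \<open>Otherwise \<open>a\<^sub>x a\<^sub>y\<close> is a normal form, and the product in the other order is either a different normal form of
  length two or an element of length one.\<close>

lemma commuting_generators_incident:
  assumes "x \<in> P" "y \<in> P" "x \<noteq> y"
    and comm: "gen x \<otimes>\<^bsub>\<Gamma>\<^esub> gen y = gen y \<otimes>\<^bsub>\<Gamma>\<^esub> gen x"
  shows "I y (lam x)"
proof (rule ccontr)
  assume "\<not> I y (lam x)"
  then have red: "reduced [(x, True), (y, True)]"
    by (auto simp: reduced_def elim: rewrite.cases dest: triple_incident)
  have xy: "gen x \<otimes>\<^bsub>\<Gamma>\<^esub> gen y = element [(x, True), (y, True)]"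
    "gen y \<otimes>\<^bsub>\<Gamma>\<^esub> gen x = element [(y, True), (x, True)]"
    using assms(1,2) by (simp_all add: gen_eq_element element_mult)
  show False
  proof (cases "I x (lam y)")
    case True
    then obtain z where z: "(y, x, z) \<in> T" using extends_iff assms(1,2) by blast
    then have "([(x, True), (y, True)], [(z, False)]) \<in> word_rel P (triangle_relators T)"
      using gen_mult_gen[OF z] comm xy(1) assms(1,2) triple_points[OF z] by (simp flip: element_eq_iff)
    then show False using reduced_shortest[OF _ red] by fastforce
  next
    case False
    then have "reduced [(y, True), (x, True)]"
      by (auto simp: reduced_def elim: rewrite.cases dest: triple_incident)
    moreover have "([(x, True), (y, True)], [(y, True), (x, True)]) \<in> word_rel P (triangle_relators T)"
      using comm xy assms(1,2) by (simp flip: element_eq_iff)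
    ultimately show False using reduced_unique[OF _ red] assms(3) by blast
  qed
qed

lemma commuting_generators_triple:
  assumes "x \<in> P" "y \<in> P" "x \<noteq> y"
    and comm: "gen x \<otimes>\<^bsub>\<Gamma>\<^esub> gen y = gen y \<otimes>\<^bsub>\<Gamma>\<^esub> gen x"
  obtains z where "(x, y, z) \<in> T" "(y, x, z) \<in> T"
proof -
  obtain z where z: "(x, y, z) \<in> T"
    using commuting_generators_incident[OF assms] extends_iff assms by blast
  obtain z' where z': "(y, x, z') \<in> T"
    using commuting_generators_incident[OF assms(2,1)] extends_iff assms by metis
  have "([(z, False)], [(z', False)]) \<in> word_rel P (triangle_relators T)"
    using gen_mult_gen[OF z] gen_mult_gen[OF z'] comm triple_points[OF z] triple_points[OF z']
    by (simp flip: element_eq_iff)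
  then have "z = z'" using reduced_unique[of "[(z, False)]" "[(z', False)]"] by (simp add: reduced_def)
  then show ?thesis using that z z' by blast
qed

text \<open>If the third point \<open>z\<close> of the triple through \<open>a\<close>, \<open>b\<close> were not \<open>c\<close>, the distinct lines
  \<open>\<lambda>(a)\<close> and \<open>\<lambda>(b)\<close> would meet in both.\<close>

lemma commuting_generators_form_triangle:
  assumes "a \<in> P" "b \<in> P" "c \<in> P" "a \<noteq> b" "a \<noteq> c" "b \<noteq> c"
    and "gen a \<otimes>\<^bsub>\<Gamma>\<^esub> gen b = gen b \<otimes>\<^bsub>\<Gamma>\<^esub> gen a"
    and "gen a \<otimes>\<^bsub>\<Gamma>\<^esub> gen c = gen c \<otimes>\<^bsub>\<Gamma>\<^esub> gen a"
    and "gen b \<otimes>\<^bsub>\<Gamma>\<^esub> gen c = gen c \<otimes>\<^bsub>\<Gamma>\<^esub> gen b"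
  shows "(a, b, c) \<in> T \<and> (b, a, c) \<in> T"
proof -
  obtain z where z: "(a, b, z) \<in> T" "(b, a, z) \<in> T"
    using commuting_generators_triple[OF assms(1,2,4,7)] .
  then have "I z (lam b)" "I z (lam a)"
    using cyclic triple_incident by blast+
  moreover have "I c (lam a)" "I c (lam b)"
    using commuting_generators_incident assms by auto
  ultimately have "z = c"
    using lam_join_unique[of z c a b] assms triple_points[OF z(1)] by blast
  then show ?thesis using z by simp
qed

end

section \<open>The flat of a commuting triangle\<close>

locale commuting_triangle = triangle_presentation P L I q lam T
  for P :: "'p set" and L :: "'l set" and I :: "'p \<Rightarrow> 'l \<Rightarrow> bool" and q lam T +
  fixes a b c :: 'p
  assumes distinct: "a \<noteq> b" "a \<noteq> c" "b \<noteq> c"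
    and abc: "(a, b, c) \<in> T" and bac: "(b, a, c) \<in> T"
begin

abbreviation V :: "'p set" where "V \<equiv> {a, b, c}"

abbreviation \<Gamma>\<^sub>0 where "\<Gamma>\<^sub>0 \<equiv> generate \<Gamma> {gen a, gen b, gen c}"

sublocale group \<Gamma> by (rule group_\<Gamma>)

lemma V_P [simp]: "u \<in> V \<Longrightarrow> u \<in> P"
  using triple_points[OF abc] by auto

lemma V_triple:
  assumes "u \<in> V" "v \<in> V" "w \<in> V" "u \<noteq> v" "u \<noteq> w" "v \<noteq> w"
  shows "(u, v, w) \<in> T"
proof -
  have "(b, c, a) \<in> T" "(c, a, b) \<in> T" "(a, c, b) \<in> T" "(c, b, a) \<in> T"
    using abc bac cyclic by blast+
  then show ?thesis using abc bac assms by auto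
qed

lemma V_third:
  assumes "u \<in> V" "v \<in> V" obtains w where "w \<in> V" "w \<noteq> u" "w \<noteq> v"
  using assms distinct by blast

lemma V_incident: "u \<in> V \<Longrightarrow> v \<in> V \<Longrightarrow> u \<noteq> v \<Longrightarrow> I v (lam u)"
  using V_triple triple_incident V_third by metis

text \<open>Otherwise the lines \<open>\<lambda>(u)\<close> and \<open>\<lambda>(v)\<close> would both contain \<open>u\<close> and the third vertex.\<close>

lemma V_not_incident_self:
  assumes u: "u \<in> V" shows "\<not> I u (lam u)"
proof
  assume "I u (lam u)"
  obtain v where v: "v \<in> V" "v \<noteq> u" using V_third[OF u u] by blast
  obtain w where w: "w \<in> V" "w \<noteq> u" "w \<noteq> v" using V_third[OF u v(1)] by blast
  have "u = v"
  proof (rule lam_join_unique[of u w u v])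
    show "I w (lam u)" "I u (lam v)" "I w (lam v)"
      using V_incident u v w by metis+
  qed (use u v w \<open>I u (lam u)\<close> in auto)
  then show False using v by simp
qed

lemma gen_V_closed [simp]: "u \<in> V \<Longrightarrow> gen u \<in> carrier \<Gamma>"
  by (rule gen_closed) (rule V_P)

lemma gen_V_in_\<Gamma>\<^sub>0: "u \<in> V \<Longrightarrow> gen u \<in> \<Gamma>\<^sub>0"
  by (auto intro: generate.incl)

lemma gens_subset: "{gen a, gen b, gen c} \<subseteq> carrier \<Gamma>"
  by auto

lemma subgroup_\<Gamma>\<^sub>0: "subgroup \<Gamma>\<^sub>0 \<Gamma>"
  by (rule generate_is_subgroup[OF gens_subset])

lemma \<Gamma>\<^sub>0_closed: "h \<in> \<Gamma>\<^sub>0 \<Longrightarrow> h \<in> carrier \<Gamma>"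
  by (rule subgroup.mem_carrier[OF subgroup_\<Gamma>\<^sub>0])

lemma gen_V_mult_eq_inv:
  assumes "u \<in> V" "v \<in> V" "w \<in> V" "u \<noteq> v" "u \<noteq> w" "v \<noteq> w"
  shows "gen u \<otimes>\<^bsub>\<Gamma>\<^esub> gen v = inv\<^bsub>\<Gamma>\<^esub> gen w"
  using gen_mult_gen[OF V_triple[OF assms]] inv_gen_eq_element[of w] V_P[OF assms(3)] by simp

lemma gen_V_commute:
  assumes "u \<in> V" "v \<in> V"
  shows "gen u \<otimes>\<^bsub>\<Gamma>\<^esub> gen v = gen v \<otimes>\<^bsub>\<Gamma>\<^esub> gen u"
proof (cases "u = v")
  case False
  obtain w where "w \<in> V" "w \<noteq> u" "w \<noteq> v" using V_third[OF assms] by blast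
  then show ?thesis using gen_V_mult_eq_inv[of u v w] gen_V_mult_eq_inv[of v u w] assms False by metis
qed simp

lemma commutes_with_\<Gamma>\<^sub>0:
  assumes x: "x \<in> carrier \<Gamma>" and gens: "\<And>u. u \<in> V \<Longrightarrow> x \<otimes>\<^bsub>\<Gamma>\<^esub> gen u = gen u \<otimes>\<^bsub>\<Gamma>\<^esub> x"
    and "h \<in> \<Gamma>\<^sub>0"
  shows "x \<otimes>\<^bsub>\<Gamma>\<^esub> h = h \<otimes>\<^bsub>\<Gamma>\<^esub> x"
  using assms(3)
proof (induction rule: generate.induct)
  case (incl h)
  then show ?case using gens by auto
next
  case (inv h)
  then have h: "h \<in> carrier \<Gamma>" "x \<otimes>\<^bsub>\<Gamma>\<^esub> h = h \<otimes>\<^bsub>\<Gamma>\<^esub> x" using gens by auto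
  have "inv\<^bsub>\<Gamma>\<^esub> h \<otimes>\<^bsub>\<Gamma>\<^esub> (x \<otimes>\<^bsub>\<Gamma>\<^esub> h) \<otimes>\<^bsub>\<Gamma>\<^esub> inv\<^bsub>\<Gamma>\<^esub> h = inv\<^bsub>\<Gamma>\<^esub> h \<otimes>\<^bsub>\<Gamma>\<^esub> (h \<otimes>\<^bsub>\<Gamma>\<^esub> x) \<otimes>\<^bsub>\<Gamma>\<^esub> inv\<^bsub>\<Gamma>\<^esub> h"
    using h by simp
  moreover have "inv\<^bsub>\<Gamma>\<^esub> h \<otimes>\<^bsub>\<Gamma>\<^esub> (x \<otimes>\<^bsub>\<Gamma>\<^esub> h) \<otimes>\<^bsub>\<Gamma>\<^esub> inv\<^bsub>\<Gamma>\<^esub> h = inv\<^bsub>\<Gamma>\<^esub> h \<otimes>\<^bsub>\<Gamma>\<^esub> x"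
    using h(1) x by (simp add: m_assoc)
  moreover have "inv\<^bsub>\<Gamma>\<^esub> h \<otimes>\<^bsub>\<Gamma>\<^esub> (h \<otimes>\<^bsub>\<Gamma>\<^esub> x) \<otimes>\<^bsub>\<Gamma>\<^esub> inv\<^bsub>\<Gamma>\<^esub> h = x \<otimes>\<^bsub>\<Gamma>\<^esub> inv\<^bsub>\<Gamma>\<^esub> h"
    using h(1) x by (simp add: m_assoc[symmetric])
  ultimately show ?case by simp
next
  case (eng h k)
  then have "h \<in> carrier \<Gamma>" "k \<in> carrier \<Gamma>" using \<Gamma>\<^sub>0_closed by auto
  then show ?case using eng.IH x by (metis m_assoc)
qed (use x in simp)

lemma \<Gamma>\<^sub>0_commute:
  assumes "h \<in> \<Gamma>\<^sub>0" "k \<in> \<Gamma>\<^sub>0" shows "h \<otimes>\<^bsub>\<Gamma>\<^esub> k = k \<otimes>\<^bsub>\<Gamma>\<^esub> h"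
proof (rule commutes_with_\<Gamma>\<^sub>0)
  show "h \<otimes>\<^bsub>\<Gamma>\<^esub> gen u = gen u \<otimes>\<^bsub>\<Gamma>\<^esub> h" if "u \<in> V" for u
    using commutes_with_\<Gamma>\<^sub>0[of "gen u" h] gen_V_commute that assms(1) by simp
qed (use assms \<Gamma>\<^sub>0_closed in auto)

lemma \<Gamma>\<^sub>0_pow: "h \<in> \<Gamma>\<^sub>0 \<Longrightarrow> h [^]\<^bsub>\<Gamma>\<^esub> (n::nat) \<in> \<Gamma>\<^sub>0"
  using subgroup.one_closed[OF subgroup_\<Gamma>\<^sub>0] subgroup.m_closed[OF subgroup_\<Gamma>\<^sub>0]
  by (induction n) auto

definition flat_element :: "'p \<Rightarrow> nat \<Rightarrow> 'p \<Rightarrow> nat \<Rightarrow> ('p \<times> bool) list set" where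
  "flat_element u m v n = gen u [^]\<^bsub>\<Gamma>\<^esub> m \<otimes>\<^bsub>\<Gamma>\<^esub> inv\<^bsub>\<Gamma>\<^esub> gen v [^]\<^bsub>\<Gamma>\<^esub> n"

text \<open>The common powers cancel because \<open>a\<^sub>u a\<^sub>v a\<^sub>w = 1\<close>.\<close>

lemma positive_product_eq_flat_element:
  assumes V: "u \<in> V" "v \<in> V" "w \<in> V" "u \<noteq> v" "u \<noteq> w" "v \<noteq> w" and le: "k \<le> j" "j \<le> i"
  shows "gen u [^]\<^bsub>\<Gamma>\<^esub> i \<otimes>\<^bsub>\<Gamma>\<^esub> (gen v [^]\<^bsub>\<Gamma>\<^esub> j \<otimes>\<^bsub>\<Gamma>\<^esub> gen w [^]\<^bsub>\<Gamma>\<^esub> k) = flat_element u (i - j) w (j - k)"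
proof -
  obtain d e where d: "i = d + j" and e: "j = e + k"
    using le by (metis le_add_diff_inverse2)
  have inv_w: "gen u [^]\<^bsub>\<Gamma>\<^esub> j \<otimes>\<^bsub>\<Gamma>\<^esub> gen v [^]\<^bsub>\<Gamma>\<^esub> j = inv\<^bsub>\<Gamma>\<^esub> gen w [^]\<^bsub>\<Gamma>\<^esub> j"
    using pow_mult_distrib[of "gen u" "gen v" j] gen_V_commute V gen_V_mult_eq_inv[OF V(1-6)] by simp
  have cancel: "inv\<^bsub>\<Gamma>\<^esub> gen w [^]\<^bsub>\<Gamma>\<^esub> k \<otimes>\<^bsub>\<Gamma>\<^esub> gen w [^]\<^bsub>\<Gamma>\<^esub> k = \<one>\<^bsub>\<Gamma>\<^esub>"
    using V(3) by (simp add: nat_pow_inv)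
  have "gen u [^]\<^bsub>\<Gamma>\<^esub> i \<otimes>\<^bsub>\<Gamma>\<^esub> (gen v [^]\<^bsub>\<Gamma>\<^esub> j \<otimes>\<^bsub>\<Gamma>\<^esub> gen w [^]\<^bsub>\<Gamma>\<^esub> k)
      = gen u [^]\<^bsub>\<Gamma>\<^esub> d \<otimes>\<^bsub>\<Gamma>\<^esub> (gen u [^]\<^bsub>\<Gamma>\<^esub> j \<otimes>\<^bsub>\<Gamma>\<^esub> gen v [^]\<^bsub>\<Gamma>\<^esub> j) \<otimes>\<^bsub>\<Gamma>\<^esub> gen w [^]\<^bsub>\<Gamma>\<^esub> k"
    using V(1-3) by (simp add: d nat_pow_mult[symmetric] m_assoc)
  also have "\<dots> = gen u [^]\<^bsub>\<Gamma>\<^esub> d \<otimes>\<^bsub>\<Gamma>\<^esub> (inv\<^bsub>\<Gamma>\<^esub> gen w [^]\<^bsub>\<Gamma>\<^esub> e \<otimes>\<^bsub>\<Gamma>\<^esub> inv\<^bsub>\<Gamma>\<^esub> gen w [^]\<^bsub>\<Gamma>\<^esub> k) \<otimes>\<^bsub>\<Gamma>\<^esub> gen w [^]\<^bsub>\<Gamma>\<^esub> k"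
    unfolding inv_w using V(3) by (simp add: e nat_pow_mult)
  also have "\<dots> = gen u [^]\<^bsub>\<Gamma>\<^esub> d \<otimes>\<^bsub>\<Gamma>\<^esub> inv\<^bsub>\<Gamma>\<^esub> gen w [^]\<^bsub>\<Gamma>\<^esub> e"
    using V(1-3) cancel by (simp add: m_assoc)
  finally show ?thesis by (simp add: flat_element_def d e)
qed

text \<open>Positive exponents suffice, as the inverse of each of the three generators is the product of the
  other two.\<close>

lemma \<Gamma>\<^sub>0_positive:
  assumes "h \<in> \<Gamma>\<^sub>0"
  shows "\<exists>i j k. h = gen a [^]\<^bsub>\<Gamma>\<^esub> (i::nat) \<otimes>\<^bsub>\<Gamma>\<^esub> (gen b [^]\<^bsub>\<Gamma>\<^esub> (j::nat) \<otimes>\<^bsub>\<Gamma>\<^esub> gen c [^]\<^bsub>\<Gamma>\<^esub> (k::nat))"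
    (is "\<exists>i j k. h = ?pos i j k")
  using assms
proof (induction rule: generate.induct)
  case one
  have "\<one>\<^bsub>\<Gamma>\<^esub> = ?pos 0 0 0" by simp
  then show ?case by blast
next
  case (incl h)
  have "gen a = ?pos 1 0 0" "gen b = ?pos 0 1 0" "gen c = ?pos 0 0 1" by simp_all
  then show ?case using incl by blast
next
  case (inv h)
  have "inv\<^bsub>\<Gamma>\<^esub> gen a = gen b \<otimes>\<^bsub>\<Gamma>\<^esub> gen c" "inv\<^bsub>\<Gamma>\<^esub> gen b = gen a \<otimes>\<^bsub>\<Gamma>\<^esub> gen c"
    "inv\<^bsub>\<Gamma>\<^esub> gen c = gen a \<otimes>\<^bsub>\<Gamma>\<^esub> gen b"
    using gen_V_mult_eq_inv[of b c a] gen_V_mult_eq_inv[of a c b] gen_V_mult_eq_inv[of a b c] distinct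
    by auto
  then have "inv\<^bsub>\<Gamma>\<^esub> gen a = ?pos 0 1 1" "inv\<^bsub>\<Gamma>\<^esub> gen b = ?pos 1 0 1" "inv\<^bsub>\<Gamma>\<^esub> gen c = ?pos 1 1 0"
    by simp_all
  then show ?case using inv by blast
next
  case (eng h k)
  then obtain i j l i' j' l' where hk: "h = ?pos i j l" "k = ?pos i' j' l'" by blast
  have pow: "gen u [^]\<^bsub>\<Gamma>\<^esub> (n::nat) \<in> \<Gamma>\<^sub>0" if "u \<in> V" for u n
    using \<Gamma>\<^sub>0_pow gen_V_in_\<Gamma>\<^sub>0 that by blast
  have swap: "x \<otimes>\<^bsub>\<Gamma>\<^esub> (y \<otimes>\<^bsub>\<Gamma>\<^esub> z) = y \<otimes>\<^bsub>\<Gamma>\<^esub> (x \<otimes>\<^bsub>\<Gamma>\<^esub> z)"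
    if "x \<in> \<Gamma>\<^sub>0" "y \<in> \<Gamma>\<^sub>0" "z \<in> carrier \<Gamma>" for x y z
    using that \<Gamma>\<^sub>0_commute[OF that(1,2)] \<Gamma>\<^sub>0_closed by (metis m_assoc)
  let ?A = "\<lambda>n. gen a [^]\<^bsub>\<Gamma>\<^esub> (n::nat)" and ?B = "\<lambda>n. gen b [^]\<^bsub>\<Gamma>\<^esub> (n::nat)"
    and ?C = "\<lambda>n. gen c [^]\<^bsub>\<Gamma>\<^esub> (n::nat)"
  have "h \<otimes>\<^bsub>\<Gamma>\<^esub> k = ?A i \<otimes>\<^bsub>\<Gamma>\<^esub> (?B j \<otimes>\<^bsub>\<Gamma>\<^esub> (?C l \<otimes>\<^bsub>\<Gamma>\<^esub> (?A i' \<otimes>\<^bsub>\<Gamma>\<^esub> (?B j' \<otimes>\<^bsub>\<Gamma>\<^esub> ?C l'))))"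
    by (simp add: hk m_assoc)
  also have "?C l \<otimes>\<^bsub>\<Gamma>\<^esub> (?A i' \<otimes>\<^bsub>\<Gamma>\<^esub> (?B j' \<otimes>\<^bsub>\<Gamma>\<^esub> ?C l')) = ?A i' \<otimes>\<^bsub>\<Gamma>\<^esub> (?C l \<otimes>\<^bsub>\<Gamma>\<^esub> (?B j' \<otimes>\<^bsub>\<Gamma>\<^esub> ?C l'))"
    by (rule swap) (simp_all add: pow)
  also have "?C l \<otimes>\<^bsub>\<Gamma>\<^esub> (?B j' \<otimes>\<^bsub>\<Gamma>\<^esub> ?C l') = ?B j' \<otimes>\<^bsub>\<Gamma>\<^esub> (?C l \<otimes>\<^bsub>\<Gamma>\<^esub> ?C l')"
    by (rule swap) (simp_all add: pow)
  also have "?B j \<otimes>\<^bsub>\<Gamma>\<^esub> (?A i' \<otimes>\<^bsub>\<Gamma>\<^esub> (?B j' \<otimes>\<^bsub>\<Gamma>\<^esub> (?C l \<otimes>\<^bsub>\<Gamma>\<^esub> ?C l')))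
      = ?A i' \<otimes>\<^bsub>\<Gamma>\<^esub> (?B j \<otimes>\<^bsub>\<Gamma>\<^esub> (?B j' \<otimes>\<^bsub>\<Gamma>\<^esub> (?C l \<otimes>\<^bsub>\<Gamma>\<^esub> ?C l')))"
    by (rule swap) (simp_all add: pow)
  also have "?A i \<otimes>\<^bsub>\<Gamma>\<^esub> (?A i' \<otimes>\<^bsub>\<Gamma>\<^esub> (?B j \<otimes>\<^bsub>\<Gamma>\<^esub> (?B j' \<otimes>\<^bsub>\<Gamma>\<^esub> (?C l \<otimes>\<^bsub>\<Gamma>\<^esub> ?C l')))) = ?pos (i + i') (j + j') (l + l')"
    by (simp add: nat_pow_mult[symmetric] m_assoc)
  finally show ?case by blast
qed

text \<open>The flat has six sectors: the smallest of the three exponents cancels against the others, and each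
  order of the exponents leaves a different pair \<open>(u, v)\<close>.\<close>

lemma \<Gamma>\<^sub>0_flat_element:
  assumes "h \<in> \<Gamma>\<^sub>0"
  obtains u v m n where "u \<in> V" "v \<in> V" "u \<noteq> v" "h = flat_element u m v n"
proof -
  obtain i j k :: nat where h: "h = gen a [^]\<^bsub>\<Gamma>\<^esub> i \<otimes>\<^bsub>\<Gamma>\<^esub> (gen b [^]\<^bsub>\<Gamma>\<^esub> j \<otimes>\<^bsub>\<Gamma>\<^esub> gen c [^]\<^bsub>\<Gamma>\<^esub> k)"
    using \<Gamma>\<^sub>0_positive[OF assms] by blast
  have pow: "gen u [^]\<^bsub>\<Gamma>\<^esub> (n::nat) \<in> \<Gamma>\<^sub>0" if "u \<in> V" for u n
    using \<Gamma>\<^sub>0_pow gen_V_in_\<Gamma>\<^sub>0 that by blast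
  have comm: "gen u [^]\<^bsub>\<Gamma>\<^esub> (m::nat) \<otimes>\<^bsub>\<Gamma>\<^esub> gen v [^]\<^bsub>\<Gamma>\<^esub> (n::nat) = gen v [^]\<^bsub>\<Gamma>\<^esub> n \<otimes>\<^bsub>\<Gamma>\<^esub> gen u [^]\<^bsub>\<Gamma>\<^esub> m"
    if "u \<in> V" "v \<in> V" for u v m n
    by (rule \<Gamma>\<^sub>0_commute) (use pow that in auto)
  have lcomm: "gen u [^]\<^bsub>\<Gamma>\<^esub> (m::nat) \<otimes>\<^bsub>\<Gamma>\<^esub> (gen v [^]\<^bsub>\<Gamma>\<^esub> (n::nat) \<otimes>\<^bsub>\<Gamma>\<^esub> x)
      = gen v [^]\<^bsub>\<Gamma>\<^esub> n \<otimes>\<^bsub>\<Gamma>\<^esub> (gen u [^]\<^bsub>\<Gamma>\<^esub> m \<otimes>\<^bsub>\<Gamma>\<^esub> x)"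
    if "u \<in> V" "v \<in> V" "x \<in> carrier \<Gamma>" for u v m n x
    using that comm[OF that(1,2), of m n] m_assoc[of "gen u [^]\<^bsub>\<Gamma>\<^esub> m" "gen v [^]\<^bsub>\<Gamma>\<^esub> n" x]
      m_assoc[of "gen v [^]\<^bsub>\<Gamma>\<^esub> n" "gen u [^]\<^bsub>\<Gamma>\<^esub> m" x] by simp
  have V: "a \<in> V" "b \<in> V" "c \<in> V" by auto
  have h': "h = gen a [^]\<^bsub>\<Gamma>\<^esub> i \<otimes>\<^bsub>\<Gamma>\<^esub> (gen c [^]\<^bsub>\<Gamma>\<^esub> k \<otimes>\<^bsub>\<Gamma>\<^esub> gen b [^]\<^bsub>\<Gamma>\<^esub> j)"
    using h comm[OF V(2,3)] by simp
  have bs: "h = gen b [^]\<^bsub>\<Gamma>\<^esub> j \<otimes>\<^bsub>\<Gamma>\<^esub> (gen a [^]\<^bsub>\<Gamma>\<^esub> i \<otimes>\<^bsub>\<Gamma>\<^esub> gen c [^]\<^bsub>\<Gamma>\<^esub> k)"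
    "h = gen b [^]\<^bsub>\<Gamma>\<^esub> j \<otimes>\<^bsub>\<Gamma>\<^esub> (gen c [^]\<^bsub>\<Gamma>\<^esub> k \<otimes>\<^bsub>\<Gamma>\<^esub> gen a [^]\<^bsub>\<Gamma>\<^esub> i)"
    using h lcomm[OF V(1,2)] comm[OF V(1,3)] by simp_all
  have cs: "h = gen c [^]\<^bsub>\<Gamma>\<^esub> k \<otimes>\<^bsub>\<Gamma>\<^esub> (gen a [^]\<^bsub>\<Gamma>\<^esub> i \<otimes>\<^bsub>\<Gamma>\<^esub> gen b [^]\<^bsub>\<Gamma>\<^esub> j)"
    "h = gen c [^]\<^bsub>\<Gamma>\<^esub> k \<otimes>\<^bsub>\<Gamma>\<^esub> (gen b [^]\<^bsub>\<Gamma>\<^esub> j \<otimes>\<^bsub>\<Gamma>\<^esub> gen a [^]\<^bsub>\<Gamma>\<^esub> i)"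
    using h' lcomm[OF V(1,3)] comm[OF V(1,2)] by simp_all
  note flat = positive_product_eq_flat_element
  consider "k \<le> j" "j \<le> i" | "j \<le> k" "k \<le> i" | "k \<le> i" "i \<le> j" | "i \<le> k" "k \<le> j"
    | "j \<le> i" "i \<le> k" | "i \<le> j" "j \<le> k" by linarith
  then show ?thesis
  proof cases
    case 1
    then show ?thesis using that[OF V(1,3)] h flat[OF V(1,2,3)] distinct by metis
  next
    case 2
    then show ?thesis using that[OF V(1,2)] h' flat[OF V(1,3,2)] distinct by metis
  next
    case 3
    then show ?thesis using that[OF V(2,3)] bs(1) flat[OF V(2,1,3)] distinct by metis
  next
    case 4
    then show ?thesis using that[OF V(2,1)] bs(2) flat[OF V(2,3,1)] distinct by metis
  next
    case 5
    then show ?thesis using that[OF V(3,2)] cs(1) flat[OF V(3,1,2)] distinct by metis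
  next
    case 6
    then show ?thesis using that[OF V(3,1)] cs(2) flat[OF V(3,2,1)] distinct by metis
  qed
qed

lemma flat_element_eq:
  assumes "u \<in> V" "v \<in> V"
  shows "flat_element u m v n = element (replicate m (u, True) @ replicate n (v, False))"
  using assms V_P by (simp only: flat_element_def gen_pow inv_gen_pow element_mult replicate_words)

lemma flat_element_inverse:
  assumes "u \<in> V" "v \<in> V"
  shows "inv\<^bsub>\<Gamma>\<^esub> flat_element u m v n = flat_element v n u m"
  using assms by (simp add: flat_element_def inv_mult_group nat_pow_inv)

lemma reduced_flat_word:
  assumes "u \<in> V" "v \<in> V" "u \<noteq> v"
  shows "reduced (replicate m (u, True) @ replicate n (v, False))"
proof -
  have "successively (\<lambda>x y. \<not> I y (lam x)) (replicate m u)"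
  proof (induction m)
    case (Suc m)
    then show ?case using V_not_incident_self[OF assms(1)] by (cases m) auto
  qed simp
  then show ?thesis
    using reduced_positive_negative[of "replicate m u" v n] V_not_incident_self[OF assms(2)] assms(3)
    by (simp add: map_replicate)
qed

lemma flat_element_eq_one:
  assumes "u \<in> V" "v \<in> V" "u \<noteq> v" "flat_element u m v n = \<one>\<^bsub>\<Gamma>\<^esub>"
  shows "m = 0" "n = 0"
proof -
  let ?w = "replicate m (u, True) @ replicate n (v, False)"
  have "?w \<in> words P" using assms(1,2) V_P by (simp only: words_append replicate_words)
  then have "(?w, []) \<in> word_rel P (triangle_relators T)"
    using assms by (simp add: flat_element_eq flip: element_Nil element_eq_iff)
  then have "?w = []"
    by (rule reduced_unique) (use reduced_flat_word[OF assms(1-3)] in \<open>auto simp: reduced_def\<close>)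
  then show "m = 0" "n = 0" by auto
qed

text \<open>Powers multiply the exponents \<open>m\<close> and \<open>n\<close>, and the resulting word is again reduced.\<close>

lemma \<Gamma>\<^sub>0_torsion_free:
  assumes "h \<in> \<Gamma>\<^sub>0" "h [^]\<^bsub>\<Gamma>\<^esub> (k::nat) = \<one>\<^bsub>\<Gamma>\<^esub>" "k > 0"
  shows "h = \<one>\<^bsub>\<Gamma>\<^esub>"
proof -
  obtain u v m n where uv: "u \<in> V" "v \<in> V" "u \<noteq> v" and h: "h = flat_element u m v n"
    using \<Gamma>\<^sub>0_flat_element[OF assms(1)] by blast
  let ?x = "gen u [^]\<^bsub>\<Gamma>\<^esub> m" and ?y = "inv\<^bsub>\<Gamma>\<^esub> gen v [^]\<^bsub>\<Gamma>\<^esub> n"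
  have "?x \<in> \<Gamma>\<^sub>0" "?y \<in> \<Gamma>\<^sub>0"
    using uv subgroup.m_inv_closed[OF subgroup_\<Gamma>\<^sub>0] by (auto intro!: \<Gamma>\<^sub>0_pow gen_V_in_\<Gamma>\<^sub>0)
  then have "h [^]\<^bsub>\<Gamma>\<^esub> k = ?x [^]\<^bsub>\<Gamma>\<^esub> k \<otimes>\<^bsub>\<Gamma>\<^esub> ?y [^]\<^bsub>\<Gamma>\<^esub> k"
    unfolding h flat_element_def by (intro pow_mult_distrib \<Gamma>\<^sub>0_commute \<Gamma>\<^sub>0_closed)
  also have "\<dots> = flat_element u (m * k) v (n * k)"
    using uv(1,2) by (simp add: flat_element_def nat_pow_pow)
  finally have "m * k = 0" "n * k = 0"
    using flat_element_eq_one[OF uv, of "m * k" "n * k"] assms(2) by (simp_all only:)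
  then show ?thesis using assms(3) by (simp add: h flat_element_def)
qed

section \<open>Words leaving the flat in general position\<close>

text \<open>The condition on the first letter makes \<open>u x\<^sub>1\<close> reduced for every vertex \<open>u\<close>, so that a power of
  \<open>u\<close> can be put in front. The condition on the last letter does the same for a word \<open>s\<^sup>i t\<^sup>-\<^sup>j\<close> that is
  put behind.\<close>

definition transverse_words :: "'p list set" where
  "transverse_words = {xs. xs \<noteq> [] \<and> set xs \<subseteq> P \<and> successively (\<lambda>x y. \<not> I y (lam x)) xs \<and>
    (\<forall>u\<in>V. \<not> I (hd xs) (lam u) \<and> \<not> I u (lam (last xs)))}"

abbreviation positive :: "'p list \<Rightarrow> ('p \<times> bool) list" where
  "positive xs \<equiv> map (\<lambda>x. (x, True)) xs"

lemma positive_words: "set xs \<subseteq> P \<Longrightarrow> positive xs \<in> words P"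
  by (auto simp: words_def)

lemma reduced_transverse:
  assumes xs: "xs \<in> transverse_words" and V: "u \<in> V" "s \<in> V" "t \<in> V" "s \<noteq> t"
  shows "reduced (positive (replicate k u @ xs @ replicate i s) @ replicate j (t, False))"
proof (rule reduced_positive_negative)
  have rep: "successively (\<lambda>x y. \<not> I y (lam x)) (replicate n w)" if "w \<in> V" for w n
  proof (induction n)
    case (Suc n)
    then show ?case using V_not_incident_self[OF that] by (cases n) auto
  qed simp
  show "successively (\<lambda>x y. \<not> I y (lam x)) (replicate k u @ xs @ replicate i s)"
    using xs rep[OF V(1)] rep[OF V(2)] V
    by (auto simp: successively_append_iff transverse_words_def)
  show "\<not> I t (lam t)" by (rule V_not_incident_self[OF V(3)])
  obtain w where "w \<in> V" "w \<noteq> t" using V_third[OF V(3,3)] by blast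
  \<comment> \<open>The line \<open>\<lambda>(t)\<close> contains the other vertices, and \<open>\<lambda>\<close> of the last letter contains none. This matters
    when \<open>i = 0\<close>.\<close>
  then have "last xs \<noteq> t"
    using V_incident[OF V(3), of w] xs by (auto simp: transverse_words_def)
  then show "last (replicate k u @ xs @ replicate i s) \<noteq> t"
    using xs V(4) by (cases i) (auto simp: transverse_words_def last_append)
qed

text \<open>Write \<open>h = u\<^sup>m v\<^sup>-\<^sup>n\<close> and \<open>k = s\<^sup>i t\<^sup>-\<^sup>j\<close>, and let \<open>w\<close> be the third vertex of the triangle, so that
  \<open>v\<^sup>-\<^sup>1 = u w\<close>. Then \<open>h g k = g'\<close> becomes \<open>u\<^sup>m\<^sup>+\<^sup>n g s\<^sup>i t\<^sup>-\<^sup>j = w\<^sup>-\<^sup>n g'\<close>. The left side is reduced, so it is at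
  most as long as the right side.\<close>

lemma transverse_length_increase:
  assumes xs: "xs \<in> transverse_words" and ys: "ys \<in> transverse_words"
    and V: "u \<in> V" "v \<in> V" "u \<noteq> v" "s \<in> V" "t \<in> V" "s \<noteq> t"
    and eq: "flat_element u m v n \<otimes>\<^bsub>\<Gamma>\<^esub> element (positive xs) \<otimes>\<^bsub>\<Gamma>\<^esub> flat_element s i t j
      = element (positive ys)"
  shows "m + length xs + i + j \<le> length ys"
proof -
  obtain w where w: "w \<in> V" "w \<noteq> u" "w \<noteq> v" using V_third[OF V(1,2)] by blast
  have words: "positive xs \<in> words P" "positive ys \<in> words P"
    using xs ys by (auto simp: transverse_words_def intro!: positive_words)
  let ?g = "element (positive xs)" and ?g' = "element (positive ys)" and ?k = "flat_element s i t j"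
  let ?U = "gen u [^]\<^bsub>\<Gamma>\<^esub> (m + n)" and ?W = "gen w [^]\<^bsub>\<Gamma>\<^esub> n"
  have closed: "?g \<in> carrier \<Gamma>" "?g' \<in> carrier \<Gamma>" "?k \<in> carrier \<Gamma>" "?U \<in> carrier \<Gamma>" "?W \<in> carrier \<Gamma>"
    using words V w by (auto simp: element_closed flat_element_def)
  have "inv\<^bsub>\<Gamma>\<^esub> gen v [^]\<^bsub>\<Gamma>\<^esub> n = gen u [^]\<^bsub>\<Gamma>\<^esub> n \<otimes>\<^bsub>\<Gamma>\<^esub> ?W"
    using pow_mult_distrib[of "gen u" "gen w" n] gen_V_commute[OF V(1) w(1)]
      gen_V_mult_eq_inv[of u w v] V w by auto
  then have "flat_element u m v n = ?U \<otimes>\<^bsub>\<Gamma>\<^esub> ?W"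
    using V(1) w(1) by (simp add: flat_element_def nat_pow_mult[symmetric] m_assoc)
  also have "\<dots> = ?W \<otimes>\<^bsub>\<Gamma>\<^esub> ?U"
    using V w by (intro \<Gamma>\<^sub>0_commute \<Gamma>\<^sub>0_pow gen_V_in_\<Gamma>\<^sub>0)
  finally have "?W \<otimes>\<^bsub>\<Gamma>\<^esub> (?U \<otimes>\<^bsub>\<Gamma>\<^esub> ?g \<otimes>\<^bsub>\<Gamma>\<^esub> ?k) = ?g'"
    using eq closed by (simp add: m_assoc)
  then have "?U \<otimes>\<^bsub>\<Gamma>\<^esub> ?g \<otimes>\<^bsub>\<Gamma>\<^esub> ?k = inv\<^bsub>\<Gamma>\<^esub> ?W \<otimes>\<^bsub>\<Gamma>\<^esub> ?g'"
    using closed by (intro inv_solve_left[THEN iffD2]) auto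
  also have "inv\<^bsub>\<Gamma>\<^esub> ?W = element (replicate n (w, False))"
    using w(1) by (simp add: inv_gen_pow[symmetric] nat_pow_inv)
  also have "?U = element (replicate (m + n) (u, True))"
    using gen_pow V(1) V_P by blast
  also have "?k = element (replicate i (s, True) @ replicate j (t, False))"
    by (rule flat_element_eq[OF V(4,5)])
  finally have "element (positive (replicate (m + n) u @ xs @ replicate i s) @ replicate j (t, False))
      = element (replicate n (w, False) @ positive ys)"
    using words V(1,4,5) w(1) V_P by (simp add: element_mult replicate_words map_replicate)
  moreover have "positive (replicate (m + n) u @ xs @ replicate i s) @ replicate j (t, False) \<in> words P"
    "replicate n (w, False) @ positive ys \<in> words P"
    using words V(1,4,5) w(1) V_P by (simp_all add: replicate_words map_replicate)
  ultimately have "length (positive (replicate (m + n) u @ xs @ replicate i s) @ replicate j (t, False))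
      \<le> length (replicate n (w, False) @ positive ys)"
    using reduced_transverse[OF xs V(1,4,5,6)] by (intro reduced_shortest) (simp_all only: element_eq_iff)
  then show ?thesis by simp
qed

text \<open>Taking inverses turns the relation into one of the same form with the two words exchanged. The two
  length estimates add up to \<open>m + n + 2 (i + j) \<le> 0\<close>.\<close>

lemma transverse_rigid:
  assumes xs: "xs \<in> transverse_words" and ys: "ys \<in> transverse_words"
    and hk: "h \<in> \<Gamma>\<^sub>0" "k \<in> \<Gamma>\<^sub>0"
    and eq: "h \<otimes>\<^bsub>\<Gamma>\<^esub> element (positive xs) \<otimes>\<^bsub>\<Gamma>\<^esub> k = element (positive ys)"
  shows "h = \<one>\<^bsub>\<Gamma>\<^esub> \<and> k = \<one>\<^bsub>\<Gamma>\<^esub>"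
proof -
  obtain u v m n where h: "u \<in> V" "v \<in> V" "u \<noteq> v" "h = flat_element u m v n"
    using \<Gamma>\<^sub>0_flat_element[OF hk(1)] by blast
  obtain s t i j where k: "s \<in> V" "t \<in> V" "s \<noteq> t" "k = flat_element s i t j"
    using \<Gamma>\<^sub>0_flat_element[OF hk(2)] by blast
  have closed: "element (positive xs) \<in> carrier \<Gamma>" "h \<in> carrier \<Gamma>" "k \<in> carrier \<Gamma>"
    using xs hk \<Gamma>\<^sub>0_closed by (auto simp: transverse_words_def intro!: element_closed positive_words)
  have "inv\<^bsub>\<Gamma>\<^esub> h \<otimes>\<^bsub>\<Gamma>\<^esub> element (positive ys) \<otimes>\<^bsub>\<Gamma>\<^esub> inv\<^bsub>\<Gamma>\<^esub> k = element (positive xs)"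
    unfolding eq[symmetric] using closed by (simp add: m_assoc) (simp add: m_assoc[symmetric])
  then have "flat_element v n u m \<otimes>\<^bsub>\<Gamma>\<^esub> element (positive ys) \<otimes>\<^bsub>\<Gamma>\<^esub> flat_element t j s i
      = element (positive xs)"
    using h k by (simp add: flat_element_inverse)
  then have "n + length ys + j + i \<le> length xs"
    by (rule transverse_length_increase[OF ys xs h(2,1) not_sym[OF h(3)] k(2,1) not_sym[OF k(3)]])
  moreover have "m + length xs + i + j \<le> length ys"
    using transverse_length_increase[OF xs ys h(1-3) k(1-3)] eq h(4) k(4) by blast
  ultimately have "m = 0" "n = 0" "i = 0" "j = 0" by linarith+
  then show ?thesis using h(4) k(4) by (simp add: flat_element_def)
qed

text \<open>A word from \<open>x\<close> to \<open>y\<close> is lengthened by a detour from \<open>x\<close> back to \<open>x\<close>.\<close>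

lemma long_transverse_word:
  assumes q: "q \<ge> 2" shows "\<exists>xs\<in>transverse_words. n \<le> length xs"
proof -
  have V: "a \<in> P" "b \<in> P" "c \<in> P" by auto
  have inc: "I b (lam a)" "I c (lam a)" "I a (lam b)" "I c (lam b)" "I a (lam c)" "I b (lam c)"
    using V_incident distinct by auto
  obtain x where x: "x \<in> P" "\<And>u. u \<in> V \<Longrightarrow> \<not> I x (lam u)"
  proof (rule point_outside_triangle[OF q card_points_on[OF V(1)] card_points_on[OF V(2)]
        card_points_on[OF V(3)] distinct])
  qed (use V inc that in auto)
  obtain y where y: "y \<in> P" "\<And>u. u \<in> V \<Longrightarrow> \<not> I u (lam y)"
  proof (rule point_outside_triangle[OF q card_points_dual[OF V(1)] card_points_dual[OF V(2)]
        card_points_dual[OF V(3)] distinct])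
  qed (use V inc that in auto)
  obtain z where z: "z \<in> P" "\<not> I z (lam x)" "\<not> I y (lam z)" using point_outside_two[OF q x(1) y(1)] .
  obtain z' where z': "z' \<in> P" "\<not> I z' (lam x)" "\<not> I x (lam z')" using point_outside_two[OF q x(1) x(1)] .
  have "\<exists>zs. set zs \<subseteq> P \<and> successively (\<lambda>x y. \<not> I y (lam x)) (x # zs @ [y]) \<and> n \<le> length zs"
  proof (induction n)
    case 0
    have "set [z] \<subseteq> P \<and> successively (\<lambda>x y. \<not> I y (lam x)) (x # [z] @ [y])" using z by simp
    then show ?case by blast
  next
    case (Suc n)
    then obtain zs where zs: "set zs \<subseteq> P" "successively (\<lambda>x y. \<not> I y (lam x)) (x # zs @ [y])" "n \<le> length zs"
      by blast
    then have "set (z' # x # zs) \<subseteq> P \<and> successively (\<lambda>x y. \<not> I y (lam x)) (x # (z' # x # zs) @ [y])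
        \<and> Suc n \<le> length (z' # x # zs)"
      using z' x(1) by simp
    then show ?case by blast
  qed
  then obtain zs where zs: "set zs \<subseteq> P" "successively (\<lambda>x y. \<not> I y (lam x)) (x # zs @ [y])" "n \<le> length zs"
    by blast
  then have "x # zs @ [y] \<in> transverse_words"
    unfolding transverse_words_def using x y by auto
  then show ?thesis using zs(3) by (intro bexI[of _ "x # zs @ [y]"]) auto
qed

lemma infinite_transverse:
  assumes q: "q \<ge> 2" shows "infinite ((\<lambda>xs. element (positive xs)) ` transverse_words)"
proof -
  have "infinite transverse_words"
  proof
    assume "finite transverse_words"
    then have "finite (length ` transverse_words)" by simp
    then obtain N where "\<And>xs. xs \<in> transverse_words \<Longrightarrow> length xs < N"
      by (metis finite_nat_set_iff_bounded imageI)
    then show False using long_transverse_word[OF q, of N] by fastforce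
  qed
  moreover have "inj_on (\<lambda>xs. element (positive xs)) transverse_words"
  proof (rule inj_onI)
    fix xs ys assume *: "xs \<in> transverse_words" "ys \<in> transverse_words"
      "element (positive xs) = element (positive ys)"
    have red: "reduced (positive zs)" if "zs \<in> transverse_words" for zs
      using reduced_transverse[OF that, of a a b 0 0 0] distinct by simp
    have "(positive xs, positive ys) \<in> word_rel P (triangle_relators T)"
      using * element_eq_iff[of "positive xs" "positive ys"]
      by (simp add: transverse_words_def positive_words)
    then have "positive xs = positive ys" using reduced_unique red * by blast
    then show "xs = ys" by (simp add: inj_map_eq_map inj_on_def)
  qed
  ultimately show ?thesis using finite_imageD by blast
qed

sublocale flat: torsion_free_abelian_subgroup \<Gamma> \<Gamma>\<^sub>0
proof (intro torsion_free_abelian_subgroup.intro torsion_free_abelian_subgroup_axioms.intro)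
  show "group \<Gamma>" by (rule group_\<Gamma>)
  show "subgroup \<Gamma>\<^sub>0 \<Gamma>" by (rule subgroup_\<Gamma>\<^sub>0)
  show "h \<otimes>\<^bsub>\<Gamma>\<^esub> k = k \<otimes>\<^bsub>\<Gamma>\<^esub> h" if "h \<in> \<Gamma>\<^sub>0" "k \<in> \<Gamma>\<^sub>0" for h k
    using \<Gamma>\<^sub>0_commute that .
  show "h = \<one>\<^bsub>\<Gamma>\<^esub>" if "h \<in> \<Gamma>\<^sub>0" "h [^]\<^bsub>\<Gamma>\<^esub> n = \<one>\<^bsub>\<Gamma>\<^esub>" "n > 0" for h and n :: nat
    using \<Gamma>\<^sub>0_torsion_free that .
  have "gen a \<noteq> \<one>\<^bsub>\<Gamma>\<^esub>"
    using flat_element_eq_one(1)[of a b 1 0] distinct by (auto simp: flat_element_def)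
  then show "\<Gamma>\<^sub>0 \<noteq> {\<one>\<^bsub>\<Gamma>\<^esub>}" using gen_V_in_\<Gamma>\<^sub>0[of a] by auto
qed

theorem infinity_in_pukanszky_invariant_flat:
  assumes "q \<ge> 2" shows "\<infinity> \<in> pukanszky_invariant \<Gamma> \<Gamma>\<^sub>0"
proof (rule flat.infinity_in_pukanszky_invariant[OF countable_\<Gamma> infinite_transverse[OF assms]])
  show "(\<lambda>xs. element (positive xs)) ` transverse_words \<subseteq> carrier \<Gamma>"
    by (auto simp: transverse_words_def intro!: element_closed positive_words)
qed (use transverse_rigid in blast)

end

theorem corollary3p4:
  fixes P :: "'p set" and L :: "'l set" and I :: "'p \<Rightarrow> 'l \<Rightarrow> bool" and q :: nat
    and lam :: "'p \<Rightarrow> 'l" and T :: "('p \<times> 'p \<times> 'p) set" and a b c :: 'p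
  defines "\<Gamma> \<equiv> A2_group P T"
  defines "gen \<equiv> A2_generator P T"
  defines "\<Gamma>\<^sub>0 \<equiv> generate \<Gamma> {gen a, gen b, gen c}"
  assumes "triangle_presentation P L I q lam T" and "q \<ge> 2"
    and "a \<in> P" "b \<in> P" "c \<in> P"
    and "a \<noteq> b" "a \<noteq> c" "b \<noteq> c"
    and "gen a \<otimes>\<^bsub>\<Gamma>\<^esub> gen b = gen b \<otimes>\<^bsub>\<Gamma>\<^esub> gen a"
    and "gen a \<otimes>\<^bsub>\<Gamma>\<^esub> gen c = gen c \<otimes>\<^bsub>\<Gamma>\<^esub> gen a"
    and "gen b \<otimes>\<^bsub>\<Gamma>\<^esub> gen c = gen c \<otimes>\<^bsub>\<Gamma>\<^esub> gen b"
  shows "\<infinity> \<in> pukanszky_invariant \<Gamma> \<Gamma>\<^sub>0"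
proof -
  interpret triangle_presentation P L I q lam T by fact
  have "(a, b, c) \<in> T \<and> (b, a, c) \<in> T"
    by (rule commuting_generators_form_triangle) (use assms in simp_all)
  then interpret commuting_triangle P L I q lam T a b c
    using assms(9-11) by unfold_locales auto
  show ?thesis
    using infinity_in_pukanszky_invariant_flat[OF assms(5)] by (simp add: \<Gamma>\<^sub>0_def \<Gamma>_def gen_def)
qed

end
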